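(* Let $A$ be a CM-order. Let $h: \mathrm{WPic}(A) \to \mathbf{Cl}^-(A)$ be the group homomorphism sending the class of $(I,w)$ to the class of $I$. Then the kernel and the cokernel of $h$ are both annihilated by $2$.
   Context: An order is a commutative ring whose additive group is isomorphic to $\mathbb{Z}^n$ for some $n\ge0$. A CM-order is an order $A$ with no non-zero nilpotent elements, equipped with a ring automorphism $x\mapsto \bar{x}$ such that $\psi(\bar{x})=\overline{\psi(x)}$ for all $x\in A$ and all ring homomorphisms $\psi:A\to\mathbb{C}$. Let $A_{\mathbb Q}=A\otimes\mathbb{Q}$ with $\bar{\ }$ extended linearly, and $(A^+_{\mathbb Q})_{\gg 0}$ the set of $w\in A_{\mathbb Q}$ with $\psi(w)\in\mathbb{R}_{>0}$ for all ring homomorphisms $\psi:A_{\mathbb Q}\to\mathbb{C}$. A fractional $A$-ideal is a finitely generated $A$-submodule of $A_{\mathbb Q}$ spanning $A_{\mathbb Q}$ over $\mathbb{Q}$; it is invertible if $IJ=A$ for some fractional ideal $J$. $\mathrm{WPic}(A)$ is the quotient of the multiplicative group of pairs $(I,w)$ with $I$ an invertible fractional $A$-ideal, $w\in(A^+_{\mathbb Q})_{\gg0}$ and $I\bar I=Aw$ (componentwise multiplication) by the subgroup $\{(Av,v\bar v): v\in A_{\mathbb Q}^\ast\}$. $\mathbf{Cl}(A)$ is the group of invertible fractional $A$-ideals modulo principal ones $Av$, $v\in A_{\mathbb Q}^\ast$, and $\mathbf{Cl}^-(A)$ is the subgroup of classes $[I]$ for which $I\bar I$ is principal. *)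

theory Defs
  imports Complex_Main "HOL-Algebra.Algebra" "HOL-Algebra.Algebraic_Closure_Type"
begin

section \<open>CM-orders\<close>

abbreviation complex_ring :: "complex ring"
  where "complex_ring \<equiv> ring_of_type_algebra"

abbreviation rat_ring :: "rat ring"
  where "rat_ring \<equiv> ring_of_type_algebra"

text \<open>The zero ring is an order (rank 0), so rings are carrier-based rather than instances of
  a type class, where \<open>0 \<noteq> 1\<close> is built in.\<close>

locale Z_order = cring A for A (structure) +
  assumes additive_free:
    "\<exists>n::nat. add_monoid A \<cong> product_group {..<n} (\<lambda>_. integer_group)"

locale CM_order = Z_order A for A (structure) +
  fixes bar :: "'a \<Rightarrow> 'a"
  assumes reduced: "\<And>x (n::nat). x \<in> carrier A \<Longrightarrow> x [^] n = \<zero> \<Longrightarrow> x = \<zero>"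
    and bar_automorphism: "bar \<in> ring_iso A A"
    and bar_cnj: "\<And>\<psi> x. \<psi> \<in> ring_hom A complex_ring \<Longrightarrow> x \<in> carrier A \<Longrightarrow>
                   \<psi> (bar x) = cnj (\<psi> x)"


section \<open>The ring \<open>A \<otimes> \<rat>\<close>\<close>

text \<open>Every element of \<open>A \<otimes> \<rat>\<close> is a pure tensor \<open>a \<otimes> 1/n\<close> with \<open>n\<close> a non-zero integer, and
  \<open>a \<otimes> 1/m = b \<otimes> 1/n\<close> iff \<open>n a - m b\<close> is a torsion element of \<open>A\<close>. The ring \<open>A \<otimes> \<rat>\<close> is
  therefore built as the ring of fractions \<open>a/n\<close>.\<close>

definition frac_rel :: "('a, 'm) ring_scheme \<Rightarrow> (('a \<times> int) \<times> ('a \<times> int)) set"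
  where "frac_rel A = {((a, m), (b, n)).
     a \<in> carrier A \<and> b \<in> carrier A \<and> m \<noteq> 0 \<and> n \<noteq> 0 \<and>
     (\<exists>k::int. k \<noteq> 0 \<and> add_pow A (k * n) a = add_pow A (k * m) b)}"

definition frac :: "('a, 'm) ring_scheme \<Rightarrow> 'a \<Rightarrow> int \<Rightarrow> ('a \<times> int) set"
  where "frac A a n = frac_rel A `` {(a, n)}"

definition rat_ext :: "('a, 'm) ring_scheme \<Rightarrow> ('a \<times> int) set ring"
  where "rat_ext A = \<lparr>
     carrier = (carrier A \<times> {n. n \<noteq> 0}) // frac_rel A,
     monoid.mult = (\<lambda>P Q. \<Union>(a, m)\<in>P. \<Union>(b, n)\<in>Q. frac A (a \<otimes>\<^bsub>A\<^esub> b) (m * n)),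
     one = frac A \<one>\<^bsub>A\<^esub> 1,
     ring.zero = frac A \<zero>\<^bsub>A\<^esub> 1,
     add = (\<lambda>P Q. \<Union>(a, m)\<in>P. \<Union>(b, n)\<in>Q.
              frac A (add_pow A n a \<oplus>\<^bsub>A\<^esub> add_pow A m b) (m * n))\<rparr>"

text \<open>The structure maps \<open>A \<rightarrow> A \<otimes> \<rat>\<close> and \<open>\<rat> \<rightarrow> A \<otimes> \<rat>\<close>.\<close>

definition of_order :: "('a, 'm) ring_scheme \<Rightarrow> 'a \<Rightarrow> ('a \<times> int) set"
  where "of_order A a = frac A a 1"

definition rat_scalar :: "('a, 'm) ring_scheme \<Rightarrow> rat \<Rightarrow> ('a \<times> int) set"
  where "rat_scalar A q =
     frac A (add_pow A (fst (quotient_of q)) \<one>\<^bsub>A\<^esub>) (snd (quotient_of q))"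

definition bar_ext ::
    "('a, 'm) ring_scheme \<Rightarrow> ('a \<Rightarrow> 'a) \<Rightarrow> ('a \<times> int) set \<Rightarrow> ('a \<times> int) set"
  where "bar_ext A bar P = (\<Union>(a, m)\<in>P. frac A (bar a) m)"

definition totally_positive :: "('a, 'm) ring_scheme \<Rightarrow> ('a \<times> int) set set"
  where "totally_positive A = {w \<in> carrier (rat_ext A).
     \<forall>\<psi> \<in> ring_hom (rat_ext A) complex_ring. \<psi> w \<in> complex_of_real ` {0<..}}"


section \<open>Fractional ideals\<close>

text \<open>A ring \<open>S\<close> as a module, the scalar \<open>r\<close> acting as multiplication by \<open>f r\<close>.\<close>

definition module_via :: "('b, 'm) ring_scheme \<Rightarrow> ('r \<Rightarrow> 'b) \<Rightarrow> ('r, 'b) module"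
  where "module_via S f = \<lparr>
     carrier = carrier S, monoid.mult = (\<otimes>\<^bsub>S\<^esub>), one = \<one>\<^bsub>S\<^esub>,
     ring.zero = \<zero>\<^bsub>S\<^esub>, add = (\<oplus>\<^bsub>S\<^esub>), module.smult = (\<lambda>r x. f r \<otimes>\<^bsub>S\<^esub> x)\<rparr>"

definition order_span :: "('a, 'm) ring_scheme \<Rightarrow> ('a \<times> int) set set \<Rightarrow> ('a \<times> int) set set"
  where "order_span A S = (\<lambda>M. submodule M A (module_via (rat_ext A) (of_order A))) hull S"

definition rat_span :: "('a, 'm) ring_scheme \<Rightarrow> ('a \<times> int) set set \<Rightarrow> ('a \<times> int) set set"
  where "rat_span A S =
     (\<lambda>M. submodule M rat_ring (module_via (rat_ext A) (rat_scalar A))) hull S"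

definition fractional_ideal :: "('a, 'm) ring_scheme \<Rightarrow> ('a \<times> int) set set \<Rightarrow> bool"
  where "fractional_ideal A I \<longleftrightarrow>
     submodule I A (module_via (rat_ext A) (of_order A)) \<and>
     (\<exists>S. finite S \<and> S \<subseteq> carrier (rat_ext A) \<and> I = order_span A S) \<and>
     rat_span A I = carrier (rat_ext A)"

definition frac_ideal_mult ::
    "('a, 'm) ring_scheme \<Rightarrow> ('a \<times> int) set set \<Rightarrow> ('a \<times> int) set set \<Rightarrow> ('a \<times> int) set set"
  where "frac_ideal_mult A I J = order_span A {x \<otimes>\<^bsub>rat_ext A\<^esub> y | x y. x \<in> I \<and> y \<in> J}"

definition order_multiples :: "('a, 'm) ring_scheme \<Rightarrow> ('a \<times> int) set \<Rightarrow> ('a \<times> int) set set"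
  where "order_multiples A v = (\<lambda>a. of_order A a \<otimes>\<^bsub>rat_ext A\<^esub> v) ` carrier A"

definition invertible_ideal :: "('a, 'm) ring_scheme \<Rightarrow> ('a \<times> int) set set \<Rightarrow> bool"
  where "invertible_ideal A I \<longleftrightarrow> fractional_ideal A I \<and>
     (\<exists>J. fractional_ideal A J \<and> frac_ideal_mult A I J = of_order A ` carrier A)"

definition ideal_group :: "('a, 'm) ring_scheme \<Rightarrow> ('a \<times> int) set set monoid"
  where "ideal_group A = \<lparr>
     carrier = {I. invertible_ideal A I},
     monoid.mult = frac_ideal_mult A,
     one = of_order A ` carrier A\<rparr>"

definition principal_ideals :: "('a, 'm) ring_scheme \<Rightarrow> ('a \<times> int) set set set"
  where "principal_ideals A = order_multiples A ` Units (rat_ext A)"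


section \<open>Class groups\<close>

definition Cl :: "('a, 'm) ring_scheme \<Rightarrow> ('a \<times> int) set set set monoid"
  where "Cl A = ideal_group A Mod principal_ideals A"

definition ideal_class ::
    "('a, 'm) ring_scheme \<Rightarrow> ('a \<times> int) set set \<Rightarrow> ('a \<times> int) set set set"
  where "ideal_class A I = principal_ideals A #>\<^bsub>ideal_group A\<^esub> I"

definition Cl_minus :: "('a, 'm) ring_scheme \<Rightarrow> ('a \<Rightarrow> 'a) \<Rightarrow> ('a \<times> int) set set set monoid"
  where "Cl_minus A bar = (Cl A)\<lparr>carrier := {ideal_class A I | I.
     invertible_ideal A I \<and>
     frac_ideal_mult A I (bar_ext A bar ` I) \<in> principal_ideals A}\<rparr>"

definition WPic_pairs ::
    "('a, 'm) ring_scheme \<Rightarrow> ('a \<Rightarrow> 'a) \<Rightarrow> (('a \<times> int) set set \<times> ('a \<times> int) set) monoid"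
  where "WPic_pairs A bar = \<lparr>
     carrier = {(I, w). invertible_ideal A I \<and> w \<in> totally_positive A \<and>
                  frac_ideal_mult A I (bar_ext A bar ` I) = order_multiples A w},
     monoid.mult = (\<lambda>(I, w) (J, u). (frac_ideal_mult A I J, w \<otimes>\<^bsub>rat_ext A\<^esub> u)),
     one = (of_order A ` carrier A, \<one>\<^bsub>rat_ext A\<^esub>)\<rparr>"

definition WPic_principal ::
    "('a, 'm) ring_scheme \<Rightarrow> ('a \<Rightarrow> 'a) \<Rightarrow> (('a \<times> int) set set \<times> ('a \<times> int) set) set"
  where "WPic_principal A bar =
     (\<lambda>v. (order_multiples A v, v \<otimes>\<^bsub>rat_ext A\<^esub> bar_ext A bar v)) ` Units (rat_ext A)"

definition WPic ::
    "('a, 'm) ring_scheme \<Rightarrow> ('a \<Rightarrow> 'a) \<Rightarrow> (('a \<times> int) set set \<times> ('a \<times> int) set) set monoid"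
  where "WPic A bar = WPic_pairs A bar Mod WPic_principal A bar"

text \<open>The map \<open>[(I, w)] \<mapsto> [I]\<close>: all members \<open>(I, w)\<close> of a class yield the same ideal class.\<close>

definition WPic_to_Cl ::
    "('a, 'm) ring_scheme \<Rightarrow> (('a \<times> int) set set \<times> ('a \<times> int) set) set \<Rightarrow> ('a \<times> int) set set set"
  where "WPic_to_Cl A P = the_elem ((\<lambda>(I, w). ideal_class A I) ` P)"

end

theory Submission
  imports Defs
begin

text \<open>
  \<^bold>\<open>Kernel.\<close> If \<open>I = Av\<close> and \<open>I \<cdot> bar I = Aw\<close>, then \<open>bar w = w\<close> because \<open>w\<close> is totally positive, and
  \<open>(I, w)\<^sup>2 = (At, t \<cdot> bar t)\<close> for \<open>t = w v / bar v\<close>.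
  \<^bold>\<open>Cokernel.\<close> If \<open>I \<cdot> bar I = Au\<close>, then this ideal is stable under conjugation, so
  \<open>I\<^sup>2 \<cdot> bar I\<^sup>2 = A(u \<cdot> bar u)\<close>, and \<open>u \<cdot> bar u\<close> is totally positive.

  Both arguments use that an element of \<open>A\<close> is determined by its images under the ring homomorphisms
  \<open>A \<rightarrow> \<complex>\<close>. A ring homomorphism is a functional \<open>\<theta>\<close> in \<open>Hom(A, \<complex>)\<close> with \<open>\<theta> \<one> = 1\<close> that is an
  eigenvector of multiplication by every element of \<open>A\<close>. If \<open>x\<close> is not nilpotent, it has a non-zero
  eigenvalue on this finite-dimensional space, and the commuting multiplications have a joint
  eigenvector inside the eigenspace.
\<close>

section \<open>Joint eigenvectors of commuting operators\<close>

text \<open>The multiplications are made to act on additive maps A \<rightarrow> \<complex> because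
  A itself has only integer scalars: the dual offers complex eigenvalues without a scalar extension
  of A. Finite dimension then enters only through an integer relation among the n + 1 powers 1, a,
  ..., a^n in an order of rank n, which yields one polynomial in a that annihilates all functionals
  at once. The obstacle behind the factor 2 is that a generator of a principal ideal is determined
  only up to units of A. For the kernel, w and v * bar v generate the same ideal, but their quotient
  is a unit that need not have the form s * bar s. For the cokernel, u need not be real or positive
  under any homomorphism to \<complex>; only Au = A bar u is known. After squaring, one of two
  factors can be exchanged for an associate: w for v * bar v in v^2 = (v * bar v)(v / bar v), and
  bar u for u in u^2. The first exchange produces t, the second u * bar u.\<close>

lemma int_vectors_dependent:
  fixes v :: "'i \<Rightarrow> nat \<Rightarrow> int"
  assumes "finite I" "n < card I"
  shows "\<exists>c. (\<exists>i\<in>I. c i \<noteq> 0) \<and> (\<forall>j<n. (\<Sum>i\<in>I. c i * v i j) = 0)"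
  using assms
proof (induction n arbitrary: I v)
  case 0
  then show ?case by (intro exI[of _ "\<lambda>_. 1"]) (auto simp: card_gt_0_iff)
next
  case (Suc n)
  show ?case
  proof (cases "\<exists>i\<in>I. v i n \<noteq> 0")
    case False
    with Suc.IH[of I v] Suc.prems show ?thesis
      by (auto simp: less_Suc_eq)
  next
    case True
    then obtain k where k: "k \<in> I" "v k n \<noteq> 0" by blast
    \<comment> \<open>Fraction-free elimination with pivot \<open>v k\<close>: cross multiplication
      clears coordinate n and stays within the integers.\<close>
    define u where "u = (\<lambda>i j. v k n * v i j - v i n * v k j)"
    have "finite (I - {k})" "n < card (I - {k})" using Suc.prems k by auto
    from Suc.IH[OF this, of u] obtain c where c: "\<exists>i\<in>I - {k}. c i \<noteq> 0"
      "\<forall>j<n. (\<Sum>i\<in>I - {k}. c i * u i j) = 0" by blast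
    \<comment> \<open>The relation among the \<open>u i\<close>, rewritten in the
      \<open>v i\<close>. It remains non-trivial because the old coefficients are scaled by the
      non-zero pivot entry \<open>v k n\<close>.\<close>
    define d where "d = (\<lambda>i. if i = k then - (\<Sum>i\<in>I - {k}. c i * v i n) else v k n * c i)"
    have "(\<Sum>i\<in>I. d i * v i j) = (\<Sum>i\<in>I - {k}. c i * u i j)" for j
    proof -
      have "(\<Sum>i\<in>I. d i * v i j) = d k * v k j + (\<Sum>i\<in>I - {k}. d i * v i j)"
        using Suc.prems k by (simp add: sum.remove)
      also have "(\<Sum>i\<in>I - {k}. d i * v i j) = (\<Sum>i\<in>I - {k}. v k n * c i * v i j)"
        by (rule sum.cong) (auto simp: d_def)
      finally show ?thesis
        by (simp add: d_def u_def sum_distrib_right sum_distrib_left sum_subtractf algebra_simps)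
    qed
    moreover have "(\<Sum>i\<in>I - {k}. c i * u i n) = 0" by (simp add: u_def)
    moreover have "\<exists>i\<in>I. d i \<noteq> 0" using c(1) k by (auto simp: d_def)
    ultimately show ?thesis using c(2) by (intro exI[of _ d]) (auto simp: less_Suc_eq)
  qed
qed

text \<open>Split off a root r of p. Either \<phi>(a x) - r \<phi>(x) vanishes on the carrier, and
  \<phi> is the eigenvector, or it is a non-zero functional annihilated by the cofactor of smaller
  degree. \<open>U\<close> is only asked to be closed under such operators, so that it can also be
  an eigenspace. The eigenvalue is reported as a root of p because this is how 0 gets excluded
  later.\<close>

lemma (in cring) exists_eigenvector:
  fixes U :: "('a \<Rightarrow> complex) set"
  assumes stable: "\<And>\<phi> b c. \<phi> \<in> U \<Longrightarrow> b \<in> carrier R \<Longrightarrow> (\<lambda>x. \<phi> (b \<otimes> x) - c * \<phi> x) \<in> U"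
    and a: "a \<in> carrier R"
    and "\<phi> \<in> U" "\<exists>y\<in>carrier R. \<phi> y \<noteq> 0" "p \<noteq> 0"
    and "\<And>x. x \<in> carrier R \<Longrightarrow> (\<Sum>i\<le>Polynomial.degree p. poly.coeff p i * \<phi> (a [^] i \<otimes> x)) = 0"
  shows "\<exists>r \<theta>. poly p r = 0 \<and> \<theta> \<in> U \<and> (\<exists>y\<in>carrier R. \<theta> y \<noteq> 0) \<and>
           (\<forall>x\<in>carrier R. \<theta> (a \<otimes> x) = r * \<theta> x)"
  using assms(3-)
proof (induction "Polynomial.degree p" arbitrary: p \<phi>)
  case 0
  then obtain y where y: "y \<in> carrier R" "\<phi> y \<noteq> 0" by blast
  from 0(5)[OF y(1)] 0(1) y have "poly.coeff p 0 = 0" by simp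
  with 0 show ?case by (metis leading_coeff_0_iff)
next
  case (Suc d)
  have "\<not> constant (poly p)" using Suc by (simp add: constant_degree)
  then obtain r where r: "poly p r = 0" using fundamental_theorem_of_algebra by blast
  then obtain q where p: "p = [:-r, 1:] * q" by (auto simp: poly_eq_0_iff_dvd)
  with Suc.prems have q: "q \<noteq> 0" by auto
  have deg: "Polynomial.degree p = Suc (Polynomial.degree q)" unfolding p using q by (subst degree_mult_eq) auto
  define \<theta> where "\<theta> = (\<lambda>x. \<phi> (a \<otimes> x) - r * \<phi> x)"
  have \<theta>U: "\<theta> \<in> U" unfolding \<theta>_def by (rule stable) (use Suc a in auto)
  have "(\<Sum>i\<le>Polynomial.degree q. poly.coeff q i * \<theta> (a [^] i \<otimes> x)) = 0" if x: "x \<in> carrier R" for x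
  proof -
    \<comment> \<open>Multiplication by X - r shifts one copy of the coefficients of q; the other
      copy is padded by the zero coefficient at index degree q + 1, so that both sums have the same
      range.\<close>
    have eq: "p = pCons 0 q - smult r q" by (simp add: p)
    have "0 = (\<Sum>i\<le>Suc (Polynomial.degree q). poly.coeff p i * \<phi> (a [^] i \<otimes> x))"
      using Suc.prems(4)[OF x] deg by simp
    also have "\<dots> = (\<Sum>i\<le>Suc (Polynomial.degree q). poly.coeff (pCons 0 q) i * \<phi> (a [^] i \<otimes> x))
       - r * (\<Sum>i\<le>Suc (Polynomial.degree q). poly.coeff q i * \<phi> (a [^] i \<otimes> x))"
      by (simp add: eq sum_subtractf sum_distrib_left algebra_simps del: sum.atMost_Suc)
    also have "(\<Sum>i\<le>Suc (Polynomial.degree q). poly.coeff (pCons 0 q) i * \<phi> (a [^] i \<otimes> x)) =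
       (\<Sum>i\<le>Polynomial.degree q. poly.coeff q i * \<phi> (a [^] Suc i \<otimes> x))"
      by (subst sum.atMost_Suc_shift) simp
    also have "(\<Sum>i\<le>Suc (Polynomial.degree q). poly.coeff q i * \<phi> (a [^] i \<otimes> x)) =
       (\<Sum>i\<le>Polynomial.degree q. poly.coeff q i * \<phi> (a [^] i \<otimes> x))"
      by (simp add: Polynomial.coeff_eq_0)
    finally show ?thesis
      using x a by (simp add: \<theta>_def sum_subtractf sum_distrib_left algebra_simps m_ac)
  qed
  note zero = this
  show ?case
  proof (cases "\<exists>y\<in>carrier R. \<theta> y \<noteq> 0")
    case True
    have "d = Polynomial.degree q" using Suc deg by simp
    from Suc.hyps(1)[OF this \<theta>U True q zero] show ?thesis unfolding p by (auto simp: poly_mult)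
  next
    case False
    then have "\<forall>x\<in>carrier R. \<phi> (a \<otimes> x) = r * \<phi> x" by (auto simp: \<theta>_def)
    with r Suc.prems show ?thesis by blast
  qed
qed

text \<open>Induction on \<open>E\<close>, replacing \<open>U\<close> by an eigenspace of one
  element at a time. The eigenspace is still stable because the multiplications commute, and the
  polynomials remain valid because each of them annihilates all of \<open>U\<close>.\<close>

lemma (in cring) exists_joint_eigenvector:
  fixes U :: "('a \<Rightarrow> complex) set"
  assumes "finite E" "E \<subseteq> carrier R"
    and "\<And>\<phi> b c. \<phi> \<in> U \<Longrightarrow> b \<in> carrier R \<Longrightarrow> (\<lambda>x. \<phi> (b \<otimes> x) - c * \<phi> x) \<in> U"
    and "\<exists>\<phi>\<in>U. \<exists>y\<in>carrier R. \<phi> y \<noteq> 0"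
    and "\<And>a. a \<in> E \<Longrightarrow> \<exists>p. p \<noteq> 0 \<and> (\<forall>\<phi>\<in>U. \<forall>x\<in>carrier R.
           (\<Sum>i\<le>Polynomial.degree p. poly.coeff p i * \<phi> (a [^] i \<otimes> x)) = 0)"
  shows "\<exists>\<theta>\<in>U. (\<exists>y\<in>carrier R. \<theta> y \<noteq> 0) \<and>
           (\<forall>a\<in>E. \<exists>r. \<forall>x\<in>carrier R. \<theta> (a \<otimes> x) = r * \<theta> x)"
  using assms
proof (induction E arbitrary: U rule: finite_induct)
  case empty
  then show ?case by auto
next
  case (insert a E)
  from insert.prems have a: "a \<in> carrier R" by auto
  obtain \<phi> where \<phi>: "\<phi> \<in> U" "\<exists>y\<in>carrier R. \<phi> y \<noteq> 0" using insert.prems by blast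
  obtain p where p: "p \<noteq> 0" "\<forall>\<phi>\<in>U. \<forall>x\<in>carrier R. (\<Sum>i\<le>Polynomial.degree p. poly.coeff p i * \<phi> (a [^] i \<otimes> x)) = 0"
    using insert.prems(4)[of a] by blast
  obtain r \<theta> where \<theta>: "\<theta> \<in> U" "\<exists>y\<in>carrier R. \<theta> y \<noteq> 0" "\<forall>x\<in>carrier R. \<theta> (a \<otimes> x) = r * \<theta> x"
    using exists_eigenvector[of U a \<phi> p, OF insert.prems(2) a \<phi> p(1)] p(2) \<phi>(1) by blast
  define V where "V = {\<theta>\<in>U. \<forall>x\<in>carrier R. \<theta> (a \<otimes> x) = r * \<theta> x}"
  have "\<exists>\<theta>\<in>V. (\<exists>y\<in>carrier R. \<theta> y \<noteq> 0) \<and> (\<forall>a\<in>E. \<exists>r. \<forall>x\<in>carrier R. \<theta> (a \<otimes> x) = r * \<theta> x)"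
  proof (rule insert.IH)
    show "E \<subseteq> carrier R" using insert.prems by simp
    show "\<exists>\<phi>\<in>V. \<exists>y\<in>carrier R. \<phi> y \<noteq> 0" using \<theta> by (auto simp: V_def)
    show "(\<lambda>x. \<phi> (b \<otimes> x) - c * \<phi> x) \<in> V" if "\<phi> \<in> V" "b \<in> carrier R" for \<phi> b c
    proof -
      have "\<phi> (b \<otimes> (a \<otimes> x)) = r * \<phi> (b \<otimes> x)" if "x \<in> carrier R" for x
        using \<open>\<phi> \<in> V\<close> \<open>b \<in> _\<close> that a by (simp add: V_def m_lcomm[of b a x])
      then show ?thesis using that insert.prems(2)[of \<phi> b c] by (auto simp: V_def algebra_simps)
    qed
    show "\<exists>p. p \<noteq> 0 \<and> (\<forall>\<phi>\<in>V. \<forall>x\<in>carrier R. (\<Sum>i\<le>Polynomial.degree p. poly.coeff p i * \<phi> (b [^] i \<otimes> x)) = 0)"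
      if "b \<in> E" for b using insert.prems(4)[of b] that by (auto simp: V_def)
  qed
  then show ?case by (auto simp: V_def)
qed

section \<open>Complex homomorphisms separate the points of a reduced order\<close>

text \<open>Stated for an arbitrary target ring so as to serve both the integer coordinates and the
  complex functionals.\<close>

lemma (in abelian_group) additive_map:
  fixes \<phi> :: "'a \<Rightarrow> 'c::ring_1"
  assumes add: "\<And>x y. x \<in> carrier G \<Longrightarrow> y \<in> carrier G \<Longrightarrow> \<phi> (x \<oplus> y) = \<phi> x + \<phi> y"
  shows additive_map_zero: "\<phi> \<zero> = 0"
    and additive_map_add_pow: "\<And>x (k::int). x \<in> carrier G \<Longrightarrow> \<phi> (add_pow G k x) = of_int k * \<phi> x"
    and additive_map_finsum: "\<And>I g. finite I \<Longrightarrow> g \<in> I \<rightarrow> carrier G \<Longrightarrow>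
           \<phi> (finsum G g I) = (\<Sum>i\<in>I. \<phi> (g i))"
proof -
  show zero: "\<phi> \<zero> = 0" using add[of \<zero> \<zero>] by simp
  show "\<phi> (add_pow G k x) = of_int k * \<phi> x" if x: "x \<in> carrier G" for x and k :: int
  proof -
    have nat: "\<phi> (add_pow G n x) = of_nat n * \<phi> x" for n :: nat
      by (induction n) (auto simp: zero add x algebra_simps)
    have "\<phi> (\<ominus> y) = - \<phi> y" if "y \<in> carrier G" for y
      using add[of y "\<ominus> y"] that by (simp add: zero r_neg eq_neg_iff_add_eq_0 add.commute)
    then show ?thesis
      by (cases "k \<ge> 0") (auto simp: add_pow_int_ge add_pow_int_lt nat x)
  qed
  show "\<phi> (finsum G g I) = (\<Sum>i\<in>I. \<phi> (g i))" if "finite I" "g \<in> I \<rightarrow> carrier G" for I g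
    using that by (induction I rule: finite_induct) (auto simp: zero add Pi_def)
qed

section \<open>Coordinates and complex functionals of an order\<close>

context Z_order
begin

text \<open>All later use of the freeness of A: additive coordinates that jointly determine an
  element, and the preimages \<open>e j\<close> of the unit vectors.\<close>

lemma obtain_coordinates:
  obtains n :: nat and f :: "'a \<Rightarrow> nat \<Rightarrow> int" and e :: "nat \<Rightarrow> 'a"
  where "\<And>x y i. x \<in> carrier A \<Longrightarrow> y \<in> carrier A \<Longrightarrow> i < n \<Longrightarrow> f (x \<oplus> y) i = f x i + f y i"
    and "\<And>x y. x \<in> carrier A \<Longrightarrow> y \<in> carrier A \<Longrightarrow> (\<And>i. i < n \<Longrightarrow> f x i = f y i) \<Longrightarrow> x = y"
    and "\<And>j. j < n \<Longrightarrow> e j \<in> carrier A"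
    and "\<And>i j. i < n \<Longrightarrow> j < n \<Longrightarrow> f (e j) i = (if i = j then 1 else 0)"
proof -
  obtain n :: nat and f where "f \<in> iso (add_monoid A) (product_group {..<n} (\<lambda>_. integer_group))"
    using additive_free by (auto simp: is_iso_def)
  then have hom: "f \<in> hom (add_monoid A) (product_group {..<n} (\<lambda>_. integer_group))"
    and bij: "bij_betw f (carrier A) (\<Pi>\<^sub>E i\<in>{..<n}. UNIV)" by (auto simp: iso_def)
  define e where "e = (\<lambda>j. inv_into (carrier A) f (\<lambda>i\<in>{..<n}. if i = j then 1 else 0))"
  \<comment> \<open>The product group consists of extensional functions, so the unit vectors have to
    be restricted to the index set before they lie in the image.\<close>
  have mem: "(\<lambda>i\<in>{..<n}. if i = j then 1 else (0::int)) \<in> f ` carrier A" for j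
    using bij by (auto simp: bij_betw_def)
  show thesis
  proof (rule that[of n f e])
    show "f (x \<oplus> y) i = f x i + f y i" if "x \<in> carrier A" "y \<in> carrier A" "i < n" for x y i
      using hom_mult[OF hom, of x y] that by simp
    show "x = y" if "x \<in> carrier A" "y \<in> carrier A" "\<And>i. i < n \<Longrightarrow> f x i = f y i" for x y
    proof -
      have "f x \<in> (\<Pi>\<^sub>E i\<in>{..<n}. UNIV)" "f y \<in> (\<Pi>\<^sub>E i\<in>{..<n}. UNIV)"
        using bij that by (auto simp: bij_betw_def)
      then have "f x = f y" using that(3) by (auto intro: PiE_ext)
      then show ?thesis using bij that by (auto simp: bij_betw_def dest: inj_onD)
    qed
    show "e j \<in> carrier A" for j
      unfolding e_def by (rule inv_into_into[OF mem])
    show "f (e j) i = (if i = j then 1 else 0)" if "i < n" for i j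
      unfolding e_def f_inv_into_f[OF mem] using that by simp
  qed
qed

text \<open>In each coordinate this is the absence of zero divisors in \<int>.\<close>

lemma torsion_free:
  assumes "x \<in> carrier A" "add_pow A k x = \<zero>" "k \<noteq> (0::int)"
  shows "x = \<zero>"
proof -
  obtain n and f :: "'a \<Rightarrow> nat \<Rightarrow> int" and e
    where f: "\<And>x y i. x \<in> carrier A \<Longrightarrow> y \<in> carrier A \<Longrightarrow> i < n \<Longrightarrow> f (x \<oplus> y) i = f x i + f y i"
    and inj: "\<And>x y. x \<in> carrier A \<Longrightarrow> y \<in> carrier A \<Longrightarrow> (\<And>i. i < n \<Longrightarrow> f x i = f y i) \<Longrightarrow> x = y"
    using obtain_coordinates by metis
  show ?thesis
  proof (rule inj)
    show "f x i = f \<zero> i" if i: "i < n" for i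
    proof -
      note add = additive_map[of "\<lambda>x. f x i", OF f[OF _ _ i]]
      have "k * f x i = 0" using add(1) add(2)[of x k] assms(1) assms(2) by simp
      then show ?thesis using add(1) assms(3) by simp
    qed
  qed (use assms in auto)
qed

text \<open>Hom(A, \<complex>) as a set of total functions. Values off the carrier are arbitrary, so
  a functional counts as non-zero only if it is non-zero somewhere on the carrier.\<close>

definition functionals :: "('a \<Rightarrow> complex) set"
  where "functionals = {\<phi>. \<forall>x\<in>carrier A. \<forall>y\<in>carrier A. \<phi> (x \<oplus> y) = \<phi> x + \<phi> y}"

lemma functionals_stable:
  "\<phi> \<in> functionals \<Longrightarrow> b \<in> carrier A \<Longrightarrow> (\<lambda>x. \<phi> (b \<otimes> x) - c * \<phi> x) \<in> functionals"
  by (auto simp: functionals_def r_distr algebra_simps)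

text \<open>Some coordinate of x is non-zero; read in \<complex> it is the required
  functional.\<close>

lemma functionals_separate:
  assumes "x \<in> carrier A" "x \<noteq> \<zero>"
  shows "\<exists>\<phi>\<in>functionals. \<phi> x \<noteq> 0"
proof -
  obtain n and f :: "'a \<Rightarrow> nat \<Rightarrow> int" and e
    where f: "\<And>x y i. x \<in> carrier A \<Longrightarrow> y \<in> carrier A \<Longrightarrow> i < n \<Longrightarrow> f (x \<oplus> y) i = f x i + f y i"
    and inj: "\<And>x y. x \<in> carrier A \<Longrightarrow> y \<in> carrier A \<Longrightarrow> (\<And>i. i < n \<Longrightarrow> f x i = f y i) \<Longrightarrow> x = y"
    using obtain_coordinates by metis
  obtain i where i: "i < n" "f x i \<noteq> f \<zero> i" using inj[of x \<zero>] assms by auto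
  then have "f x i \<noteq> 0" using additive_map_zero[of "\<lambda>x. f x i", OF f] by auto
  with i f show ?thesis
    by (intro bexI[of _ "\<lambda>x. of_int (f x i)"]) (auto simp: functionals_def)
qed

text \<open>The coordinate vectors of 1, a, ..., a^n are n + 1 vectors of length n, hence dependent
  over \<int>, and the same relation holds in A. The polynomial depends on a alone, not on the
  functional, as the passage to eigenspaces requires.\<close>

lemma algebraic:
  assumes a: "a \<in> carrier A"
  shows "\<exists>p. p \<noteq> 0 \<and> (\<forall>\<phi>\<in>functionals. \<forall>x\<in>carrier A.
           (\<Sum>i\<le>Polynomial.degree p. poly.coeff p i * \<phi> (a [^] i \<otimes> x)) = 0)"
proof -
  obtain n and f :: "'a \<Rightarrow> nat \<Rightarrow> int" and e
    where f: "\<And>x y i. x \<in> carrier A \<Longrightarrow> y \<in> carrier A \<Longrightarrow> i < n \<Longrightarrow> f (x \<oplus> y) i = f x i + f y i"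
    and inj: "\<And>x y. x \<in> carrier A \<Longrightarrow> y \<in> carrier A \<Longrightarrow> (\<And>i. i < n \<Longrightarrow> f x i = f y i) \<Longrightarrow> x = y"
    using obtain_coordinates by metis
  obtain c where c: "\<exists>i\<le>n. c i \<noteq> 0" "\<forall>j<n. (\<Sum>i\<le>n. c i * f (a [^] i) j) = 0"
    using int_vectors_dependent[of "{..n}" n "\<lambda>i. f (a [^] i)"] by auto
  define z where "z = (\<Oplus>i\<in>{..n}. add_pow A (c i) (a [^] i))"
  have z: "z = \<zero>"
  proof (rule inj)
    show "f z j = f \<zero> j" if j: "j < n" for j
    proof -
      note add = additive_map[of "\<lambda>x. f x j", OF f[OF _ _ j]]
      have "f z j = (\<Sum>i\<le>n. c i * f (a [^] i) j)"
        unfolding z_def using a by (simp add: add(2,3))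
      then show ?thesis using add(1) c(2) j by simp
    qed
  qed (use a in \<open>auto simp: z_def intro: finsum_closed\<close>)
  define p where "p = (\<Sum>i\<le>n. Polynomial.monom (of_int (c i) :: complex) i)"
  have coeff: "poly.coeff p i = (if i \<le> n then of_int (c i) else 0)" for i
    by (simp add: p_def coeff_sum)
  have "p \<noteq> 0" using c(1) coeff by (metis coeff_0 of_int_eq_0_iff)
  moreover have "(\<Sum>i\<le>Polynomial.degree p. poly.coeff p i * \<phi> (a [^] i \<otimes> x)) = 0"
    if \<phi>: "\<phi> \<in> functionals" and x: "x \<in> carrier A" for \<phi> x
  proof -
    note add = additive_map[of "\<lambda>z. \<phi> (z \<otimes> x)"]
    have hom: "\<phi> ((z \<oplus> y) \<otimes> x) = \<phi> (z \<otimes> x) + \<phi> (y \<otimes> x)"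
      if "z \<in> carrier A" "y \<in> carrier A" for z y
      using \<phi> x that by (simp add: functionals_def l_distr)
    \<comment> \<open>The degree may be smaller than n, since \<open>c n\<close> may be 0; the
      additional terms have zero coefficients.\<close>
    have "Polynomial.degree p \<le> n" by (rule degree_le) (auto simp: coeff)
    then have "(\<Sum>i\<le>Polynomial.degree p. poly.coeff p i * \<phi> (a [^] i \<otimes> x)) =
      (\<Sum>i\<le>n. poly.coeff p i * \<phi> (a [^] i \<otimes> x))"
      by (intro sum.mono_neutral_left) (auto simp: Polynomial.coeff_eq_0)
    also have "\<dots> = (\<Sum>i\<le>n. of_int (c i) * \<phi> (a [^] i \<otimes> x))" by (simp add: coeff)
    also have "\<dots> = (\<Sum>i\<le>n. \<phi> (add_pow A (c i) (a [^] i) \<otimes> x))"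
      using a by (simp add: add(2)[OF hom])
    also have "\<dots> = \<phi> (z \<otimes> x)"
      unfolding z_def using a by (subst add(3)[OF hom]) auto
    also have "\<dots> = 0" using add(1)[OF hom] z by simp
    finally show ?thesis .
  qed
  ultimately show ?thesis by blast
qed

text \<open>The homomorphism is the eigenvalue of a joint eigenvector, as a function of the
  multiplier. Non-nilpotency ensures that the value at x is not 0: write p = X^k q with q(0)
  \<noteq> 0. Since x^k \<noteq> 0, some functional y \<mapsto> \<phi>(x^k y) is non-zero, and it is
  annihilated by q, whose roots are all non-zero.\<close>

lemma exists_complex_hom:
  assumes x: "x \<in> carrier A" and nil: "\<And>k::nat. x [^] k \<noteq> \<zero>"
  shows "\<exists>\<psi>\<in>ring_hom A complex_ring. \<psi> x \<noteq> 0"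
proof -
  obtain p where p: "p \<noteq> 0" "\<And>\<phi> y. \<phi> \<in> functionals \<Longrightarrow> y \<in> carrier A \<Longrightarrow>
      (\<Sum>i\<le>Polynomial.degree p. poly.coeff p i * \<phi> (x [^] i \<otimes> y)) = 0"
    using algebraic[OF x] by blast
  define k where "k = order 0 p"
  obtain q where q: "p = [:- 0, 1:] ^ k * q" "\<not> [:- 0, 1:] dvd q"
    using order_decomp[OF p(1), of 0] by (auto simp: k_def)
  have q0: "q \<noteq> 0" "poly q 0 \<noteq> 0" using q(2) by (auto simp: poly_eq_0_iff_dvd)
  have pq: "p = Polynomial.monom 1 k * q" using q by (simp add: monom_altdef)
  have deg: "Polynomial.degree p = Polynomial.degree q + k"
    unfolding pq using q0 by (subst degree_mult_eq) (auto simp: degree_monom_eq)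
  obtain \<phi> where \<phi>: "\<phi> \<in> functionals" "\<phi> (x [^] k) \<noteq> 0"
    using functionals_separate[of "x [^] k"] nil x by auto
  define \<phi>' where "\<phi>' = (\<lambda>y. \<phi> (x [^] k \<otimes> y))"
  have \<phi>': "\<phi>' \<in> functionals"
    using functionals_stable[OF \<phi>(1), of "x [^] k" 0] x by (simp add: \<phi>'_def)
  have nz: "\<exists>y\<in>carrier A. \<phi>' y \<noteq> 0" using \<phi> x by (auto simp: \<phi>'_def intro!: bexI[of _ \<one>])
  have "(\<Sum>i\<le>Polynomial.degree q. poly.coeff q i * \<phi>' (x [^] i \<otimes> y)) = 0"
    if y: "y \<in> carrier A" for y
  proof -
    have "(\<Sum>i\<le>Polynomial.degree q. poly.coeff q i * \<phi>' (x [^] i \<otimes> y)) =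
       (\<Sum>i=0..Polynomial.degree q. poly.coeff p (i + k) * \<phi> (x [^] (i + k) \<otimes> y))"
      unfolding pq atMost_atLeast0 \<phi>'_def using x y
      by (simp add: coeff_monom_mult m_assoc[symmetric] nat_pow_mult add.commute[of k])
    also have "\<dots> = (\<Sum>i=0+k..Polynomial.degree q+k. poly.coeff p i * \<phi> (x [^] i \<otimes> y))"
      by (rule sum.shift_bounds_cl_nat_ivl[symmetric])
    \<comment> \<open>The coefficients of p below index k are zero because X^k divides p.\<close>
    also have "\<dots> = (\<Sum>i\<le>Polynomial.degree p. poly.coeff p i * \<phi> (x [^] i \<otimes> y))"
      unfolding deg by (rule sum.mono_neutral_left) (auto simp: pq coeff_monom_mult)
    finally show ?thesis using p(2)[OF \<phi>(1) y] by simp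
  qed
  from exists_eigenvector[OF functionals_stable x \<phi>' nz q0(1) this]
  obtain r \<theta>\<^sub>0 where r: "poly q r = 0" "\<theta>\<^sub>0 \<in> functionals" "\<exists>y\<in>carrier A. \<theta>\<^sub>0 y \<noteq> 0"
      "\<forall>y\<in>carrier A. \<theta>\<^sub>0 (x \<otimes> y) = r * \<theta>\<^sub>0 y" by blast
  have "r \<noteq> 0" using r(1) q0(2) by auto
  \<comment> \<open>Any joint eigenvector found inside this eigenspace still has eigenvalue r for
    x.\<close>
  define U where "U = {\<theta>\<in>functionals. \<forall>y\<in>carrier A. \<theta> (x \<otimes> y) = r * \<theta> y}"
  obtain n and f :: "'a \<Rightarrow> nat \<Rightarrow> int" and e
    where f: "\<And>x y i. x \<in> carrier A \<Longrightarrow> y \<in> carrier A \<Longrightarrow> i < n \<Longrightarrow> f (x \<oplus> y) i = f x i + f y i"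
    and inj: "\<And>x y. x \<in> carrier A \<Longrightarrow> y \<in> carrier A \<Longrightarrow> (\<And>i. i < n \<Longrightarrow> f x i = f y i) \<Longrightarrow> x = y"
    and e: "\<And>j. j < n \<Longrightarrow> e j \<in> carrier A"
    and fe: "\<And>i j. i < n \<Longrightarrow> j < n \<Longrightarrow> f (e j) i = (if i = j then 1 else 0)"
    apply (rule obtain_coordinates)
    subgoal premises p for n f e by (rule p(1)[OF p(2-5)])
    done
  have expand: "z = (\<Oplus>j\<in>{..<n}. add_pow A (f z j) (e j))" if z: "z \<in> carrier A" for z
  proof (rule inj[OF z])
    show "f z i = f (\<Oplus>j\<in>{..<n}. add_pow A (f z j) (e j)) i" if i: "i < n" for i
    proof -
      note add = additive_map[of "\<lambda>x. f x i", OF f[OF _ _ i]]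
      show ?thesis using i e by (simp add: add(2,3) fe if_distrib cong: if_cong)
    qed
  qed (use e in \<open>auto intro!: finsum_closed\<close>)
  \<comment> \<open>Finitely many multipliers suffice: an eigenvector for the basis elements is one
    for all of A by additivity.\<close>
  have "\<exists>\<theta>\<in>U. (\<exists>y\<in>carrier A. \<theta> y \<noteq> 0) \<and>
           (\<forall>a\<in>e ` {..<n}. \<exists>s. \<forall>y\<in>carrier A. \<theta> (a \<otimes> y) = s * \<theta> y)"
  proof (rule exists_joint_eigenvector)
    show "(\<lambda>y. \<theta> (b \<otimes> y) - c * \<theta> y) \<in> U" if "\<theta> \<in> U" "b \<in> carrier A" for \<theta> b c
    proof -
      have "\<theta> (b \<otimes> (x \<otimes> y)) = r * \<theta> (b \<otimes> y)" if "y \<in> carrier A" for y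
        using \<open>\<theta> \<in> U\<close> \<open>b \<in> _\<close> that x by (simp add: U_def m_lcomm[of b x y])
      then show ?thesis using that functionals_stable[of \<theta> b c] by (auto simp: U_def algebra_simps)
    qed
    show "\<exists>\<theta>\<in>U. \<exists>y\<in>carrier A. \<theta> y \<noteq> 0" using r by (auto simp: U_def)
    show "\<exists>p. p \<noteq> 0 \<and> (\<forall>\<phi>\<in>U. \<forall>x\<in>carrier A.
        (\<Sum>i\<le>Polynomial.degree p. poly.coeff p i * \<phi> (a [^] i \<otimes> x)) = 0)"
      if "a \<in> e ` {..<n}" for a
    proof -
      have "a \<in> carrier A" "U \<subseteq> functionals" using that e by (auto simp: U_def)
      then show ?thesis using algebraic[of a] by blast
    qed
  qed (use e in auto)
  then obtain \<theta> s where \<theta>: "\<theta> \<in> U" "\<exists>y\<in>carrier A. \<theta> y \<noteq> 0"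
    and s: "\<And>j y. j < n \<Longrightarrow> y \<in> carrier A \<Longrightarrow> \<theta> (e j \<otimes> y) = s (e j) * \<theta> y"
    by (fastforce simp: bchoice_iff)
  \<comment> \<open>The eigenvalue of multiplication by z, extended additively from the basis. The
    equivalent form \<theta>(z) / \<theta>(1), obtained below, gives the ring homomorphism
    laws.\<close>
  define \<mu> where "\<mu> = (\<lambda>z. \<Sum>j<n. of_int (f z j) * s (e j))"
  have \<theta>_add: "\<theta> (y \<oplus> z) = \<theta> y + \<theta> z" if "y \<in> carrier A" "z \<in> carrier A" for y z
    using \<theta>(1) that by (auto simp: U_def functionals_def)
  have eigen: "\<theta> (z \<otimes> y) = \<mu> z * \<theta> y" if z: "z \<in> carrier A" and y: "y \<in> carrier A" for z y
  proof -
    note add = additive_map[of "\<lambda>z. \<theta> (z \<otimes> y)"]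
    have hom: "\<theta> ((z \<oplus> z') \<otimes> y) = \<theta> (z \<otimes> y) + \<theta> (z' \<otimes> y)"
      if "z \<in> carrier A" "z' \<in> carrier A" for z z'
      using \<theta>_add y that by (simp add: l_distr)
    have "\<theta> (z \<otimes> y) = \<theta> ((\<Oplus>j\<in>{..<n}. add_pow A (f z j) (e j)) \<otimes> y)" using expand[OF z] by simp
    also have "\<dots> = (\<Sum>j<n. \<theta> (add_pow A (f z j) (e j) \<otimes> y))"
      using e by (subst add(3)[OF hom]) auto
    also have "\<dots> = \<mu> z * \<theta> y"
      using e y by (simp add: add(2)[OF hom] s \<mu>_def sum_distrib_right mult.assoc)
    finally show ?thesis .
  qed
  have \<theta>1: "\<theta> z = \<mu> z * \<theta> \<one>" if "z \<in> carrier A" for z using eigen[OF that one_closed] that by simp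
  \<comment> \<open>Since \<theta>(z) = \<mu>(z) \<theta>(1), a zero at 1 would make \<theta> vanish
    on the whole carrier.\<close>
  have nz1: "\<theta> \<one> \<noteq> 0" using \<theta>(2) \<theta>1 by fastforce
  have \<mu>: "\<mu> z = \<theta> z / \<theta> \<one>" if "z \<in> carrier A" for z using \<theta>1[OF that] nz1 by simp
  have "\<mu> \<in> ring_hom A complex_ring"
    by (rule ring_hom_memI)
      (auto simp: ring_of_type_algebra_def \<mu> eigen \<theta>_add nz1 add_divide_distrib)
  moreover have "\<mu> x = r"
    using \<theta>(1) nz1 x \<mu>[OF x] by (auto simp: U_def dest!: bspec[of _ _ \<one>])
  ultimately show ?thesis using \<open>r \<noteq> 0\<close> by blast
qed

end

section \<open>Separation of points and the involution of a CM-order\<close>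

context CM_order
begin

text \<open>A non-zero difference x - y is not nilpotent, so some homomorphism does not vanish on
  it. From here on, identities involving \<open>bar\<close> can be verified on complex
  values.\<close>

lemma complex_homs_separate:
  assumes "x \<in> carrier A" "y \<in> carrier A" "\<And>\<psi>. \<psi> \<in> ring_hom A complex_ring \<Longrightarrow> \<psi> x = \<psi> y"
  shows "x = y"
proof (rule ccontr)
  assume "x \<noteq> y"
  then have "x \<ominus> y \<noteq> \<zero>" using assms by auto
  then obtain \<psi> where \<psi>: "\<psi> \<in> ring_hom A complex_ring" "\<psi> (x \<ominus> y) \<noteq> 0"
    using exists_complex_hom[of "x \<ominus> y"] reduced[of "x \<ominus> y"] assms by auto
  have "\<psi> (x \<ominus> y \<oplus> y) = \<psi> (x \<ominus> y) + \<psi> y"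
    using ring_hom_add[OF \<psi>(1)] assms by (simp add: ring_of_type_algebra_def)
  moreover have "x \<ominus> y \<oplus> y = x" using assms by (simp add: a_minus_def a_assoc l_neg)
  ultimately show False using \<psi> assms(3)[OF \<psi>(1)] by simp
qed

lemma bar_closed [simp]: "x \<in> carrier A \<Longrightarrow> bar x \<in> carrier A"
  using bar_automorphism by (auto simp: ring_iso_def ring_hom_def)

lemma bar_bar [simp]: "x \<in> carrier A \<Longrightarrow> bar (bar x) = x"
  by (rule complex_homs_separate) (auto simp: bar_cnj)

end

section \<open>The ring of fractions\<close>

context Z_order
begin

lemma add_pow_cancel:
  assumes "x \<in> carrier A" "y \<in> carrier A" "k \<noteq> (0::int)" "add_pow A k x = add_pow A k y"
  shows "x = y"
proof -
  have "add_pow A k (x \<ominus> y) = add_pow A k x \<oplus> add_pow A k (\<ominus> y)"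
    using assms by (simp add: a_minus_def add.int_pow_distrib)
  also have "\<dots> = \<zero>" using assms by (simp add: add.int_pow_inv r_neg)
  finally have "x \<ominus> y = \<zero>" using assms torsion_free[of "x \<ominus> y" k] by simp
  then show ?thesis using assms by simp
qed

lemmas add_pow_simps = add.int_pow_distrib add.int_pow_pow add_pow_ldistr_int add_pow_rdistr_int

lemma add_pow_commute:
  "x \<in> carrier A \<Longrightarrow> add_pow A (m::int) (add_pow A (n::int) x) = add_pow A n (add_pow A m x)"
  by (simp add: add_pow_simps mult.commute)

text \<open>Torsion-freeness cancels the common multiplier, so that fractions are compared by cross
  multiplication.\<close>

lemma frac_rel_iff: "((a, m), (b, n)) \<in> frac_rel A \<longleftrightarrow>
    a \<in> carrier A \<and> b \<in> carrier A \<and> m \<noteq> 0 \<and> n \<noteq> 0 \<and> add_pow A n a = add_pow A m b"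
proof (cases "a \<in> carrier A \<and> b \<in> carrier A")
  case True
  have "add_pow A n a = add_pow A m b"
    if "k \<noteq> 0" "add_pow A (k * n) a = add_pow A (k * m) b" for k
    by (rule add_pow_cancel[of _ _ k]) (use that True in \<open>simp_all add: add_pow_simps mult.commute\<close>)
  then show ?thesis using True by (auto simp: frac_rel_def intro: exI[of _ 1])
qed (auto simp: frac_rel_def)

lemma mem_frac_iff: "(b, n) \<in> frac A a m \<longleftrightarrow>
    a \<in> carrier A \<and> b \<in> carrier A \<and> m \<noteq> 0 \<and> n \<noteq> 0 \<and> add_pow A n a = add_pow A m b"
  by (simp add: frac_def frac_rel_iff)

lemma equiv_frac_rel: "equiv (carrier A \<times> {n. n \<noteq> 0}) (frac_rel A)"
proof (rule equivI)
  show "trans (frac_rel A)"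
  proof (rule transI, clarify)
    fix a b c :: 'a and m n p :: int
    assume "((a, m), (b, n)) \<in> frac_rel A" "((b, n), (c, p)) \<in> frac_rel A"
    then have *: "a \<in> carrier A" "b \<in> carrier A" "c \<in> carrier A" "m \<noteq> 0" "n \<noteq> 0" "p \<noteq> 0"
      "add_pow A n a = add_pow A m b" "add_pow A p b = add_pow A n c"
      by (auto simp: frac_rel_iff)
    \<comment> \<open>Transitivity is first obtained after multiplication by the middle denominator
      n, which is then cancelled.\<close>
    have "add_pow A n (add_pow A p a) = add_pow A p (add_pow A m b)"
      using * add_pow_commute[of a n p] by simp
    also have "\<dots> = add_pow A n (add_pow A m c)"
      using * add_pow_commute[of b p m] add_pow_commute[of c n m] by simp
    finally show "((a, m), (c, p)) \<in> frac_rel A"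
      using * add_pow_cancel[of "add_pow A p a" "add_pow A m c" n] by (simp add: frac_rel_iff)
  qed
qed (auto simp: refl_on_def sym_def frac_rel_iff)

lemma frac_eq_iff:
  assumes "a \<in> carrier A" "b \<in> carrier A" "m \<noteq> 0" "n \<noteq> 0"
  shows "frac A a m = frac A b n \<longleftrightarrow> add_pow A n a = add_pow A m b"
  using eq_equiv_class_iff[OF equiv_frac_rel, of "(a, m)" "(b, n)"] assms
  by (simp add: frac_def frac_rel_iff)

lemma carrier_rat_ext_iff:
  "P \<in> carrier (rat_ext A) \<longleftrightarrow> (\<exists>a m. a \<in> carrier A \<and> m \<noteq> 0 \<and> P = frac A a m)"
  by (auto simp: rat_ext_def quotient_def frac_def)

lemma rat_ext_cases:
  assumes "P \<in> carrier (rat_ext A)"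
  obtains a m where "a \<in> carrier A" "m \<noteq> 0" "P = frac A a m"
  using assms by (auto simp: carrier_rat_ext_iff)

lemma frac_closed [simp]: "a \<in> carrier A \<Longrightarrow> m \<noteq> 0 \<Longrightarrow> frac A a m \<in> carrier (rat_ext A)"
  by (auto simp: carrier_rat_ext_iff)

text \<open>The operations on fractions are unions over all representatives. Once every
  representative gives the same set, the union over the non-empty class is that set;
  well-definedness of an operation is thus the only obligation.\<close>

lemma UN_frac:
  assumes "a \<in> carrier A" "m \<noteq> 0"
    and "\<And>b n. b \<in> carrier A \<Longrightarrow> n \<noteq> 0 \<Longrightarrow> add_pow A n a = add_pow A m b \<Longrightarrow> F b n = C"
  shows "(\<Union>(b, n)\<in>frac A a m. F b n) = C"
proof -
  have "(a, m) \<in> frac A a m" using assms by (simp add: mem_frac_iff)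
  moreover have "(case p of (b, n) \<Rightarrow> F b n) = C" if "p \<in> frac A a m" for p
    using that assms(3) by (cases p) (auto simp: mem_frac_iff)
  ultimately show ?thesis by blast
qed

lemma frac_mult:
  assumes "a \<in> carrier A" "b \<in> carrier A" "m \<noteq> 0" "n \<noteq> 0"
  shows "frac A a m \<otimes>\<^bsub>rat_ext A\<^esub> frac A b n = frac A (a \<otimes> b) (m * n)"
proof -
  have "frac A (a' \<otimes> b') (m' * n') = frac A (a \<otimes> b) (m * n)"
    if *: "a' \<in> carrier A" "m' \<noteq> 0" "add_pow A m' a = add_pow A m a'"
      "b' \<in> carrier A" "n' \<noteq> 0" "add_pow A n' b = add_pow A n b'" for a' m' b' n'
  proof -
    have "add_pow A (m * n) (a' \<otimes> b') = add_pow A m a' \<otimes> add_pow A n b'"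
      using * by (simp add: add_pow_simps mult.commute)
    also have "\<dots> = add_pow A m' a \<otimes> add_pow A n' b" using * by simp
    also have "\<dots> = add_pow A (m' * n') (a \<otimes> b)"
      using assms by (simp add: add_pow_simps mult.commute)
    finally show ?thesis using assms * by (simp add: frac_eq_iff)
  qed
  note eq = this
  have "frac A a m \<otimes>\<^bsub>rat_ext A\<^esub> frac A b n = (\<Union>(a', m')\<in>frac A a m. \<Union>(b', n')\<in>frac A b n.
      frac A (a' \<otimes> b') (m' * n'))"
    by (simp add: rat_ext_def)
  then show ?thesis
    by (simp only:) (intro UN_frac eq assms; assumption)
qed

lemma frac_add:
  assumes "a \<in> carrier A" "b \<in> carrier A" "m \<noteq> 0" "n \<noteq> 0"
  shows "frac A a m \<oplus>\<^bsub>rat_ext A\<^esub> frac A b n = frac A (add_pow A n a \<oplus> add_pow A m b) (m * n)"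
proof -
  have "frac A (add_pow A n' a' \<oplus> add_pow A m' b') (m' * n') =
      frac A (add_pow A n a \<oplus> add_pow A m b) (m * n)"
    if *: "a' \<in> carrier A" "m' \<noteq> 0" "add_pow A m' a = add_pow A m a'"
      "b' \<in> carrier A" "n' \<noteq> 0" "add_pow A n' b = add_pow A n b'" for a' m' b' n'
  proof -
    have "add_pow A (m * n) (add_pow A n' a' \<oplus> add_pow A m' b') =
        add_pow A (n * n') (add_pow A m a') \<oplus> add_pow A (m * m') (add_pow A n b')"
      using * by (simp add: add_pow_simps mult_ac)
    also have "\<dots> = add_pow A (n * n') (add_pow A m' a) \<oplus> add_pow A (m * m') (add_pow A n' b)"
      using * by simp
    also have "\<dots> = add_pow A (m' * n') (add_pow A n a \<oplus> add_pow A m b)"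
      using assms by (simp add: add_pow_simps mult_ac)
    finally show ?thesis using assms * by (simp add: frac_eq_iff)
  qed
  note eq = this
  have "frac A a m \<oplus>\<^bsub>rat_ext A\<^esub> frac A b n = (\<Union>(a', m')\<in>frac A a m. \<Union>(b', n')\<in>frac A b n.
      frac A (add_pow A n' a' \<oplus> add_pow A m' b') (m' * n'))"
    by (simp add: rat_ext_def)
  then show ?thesis
    by (simp only:) (intro UN_frac eq assms; assumption)
qed

lemma rat_ext_zero: "\<zero>\<^bsub>rat_ext A\<^esub> = frac A \<zero> 1"
  and rat_ext_one: "\<one>\<^bsub>rat_ext A\<^esub> = frac A \<one> 1"
  by (simp_all add: rat_ext_def)

lemma rat_ext_cring: "cring (rat_ext A)"
proof (rule cringI)
  show "abelian_group (rat_ext A)"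
  proof (rule abelian_groupI)
    show "\<exists>y\<in>carrier (rat_ext A). y \<oplus>\<^bsub>rat_ext A\<^esub> x = \<zero>\<^bsub>rat_ext A\<^esub>"
      if x: "x \<in> carrier (rat_ext A)" for x
    proof -
      obtain a m where "a \<in> carrier A" "m \<noteq> 0" "x = frac A a m"
        using x by (auto simp: carrier_rat_ext_iff)
      then show ?thesis
        by (intro bexI[of _ "frac A (\<ominus> a) m"])
          (auto simp: frac_add rat_ext_zero frac_eq_iff add.int_pow_inv l_neg add_pow_simps)
    qed
  next
    fix x y assume "x \<in> carrier (rat_ext A)" "y \<in> carrier (rat_ext A)"
    then obtain a m b n where *: "a \<in> carrier A" "m \<noteq> 0" "x = frac A a m"
      "b \<in> carrier A" "n \<noteq> 0" "y = frac A b n" by (auto simp: carrier_rat_ext_iff)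
    then show "x \<oplus>\<^bsub>rat_ext A\<^esub> y \<in> carrier (rat_ext A)" by (simp add: frac_add)
    show "x \<oplus>\<^bsub>rat_ext A\<^esub> y = y \<oplus>\<^bsub>rat_ext A\<^esub> x"
      using * by (simp add: frac_add a_comm mult.commute)
    fix z assume "z \<in> carrier (rat_ext A)"
    then obtain c p where "c \<in> carrier A" "p \<noteq> 0" "z = frac A c p"
      by (auto simp: carrier_rat_ext_iff)
    then show "x \<oplus>\<^bsub>rat_ext A\<^esub> y \<oplus>\<^bsub>rat_ext A\<^esub> z = x \<oplus>\<^bsub>rat_ext A\<^esub> (y \<oplus>\<^bsub>rat_ext A\<^esub> z)"
      using * by (simp add: frac_add add_pow_simps a_assoc mult_ac)
  qed (auto simp: rat_ext_zero frac_add elim!: rat_ext_cases)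
  show "comm_monoid (rat_ext A)"
    by (rule comm_monoidI)
      (auto simp: rat_ext_one frac_mult m_ac mult_ac elim!: rat_ext_cases)
  show "(x \<oplus>\<^bsub>rat_ext A\<^esub> y) \<otimes>\<^bsub>rat_ext A\<^esub> z = x \<otimes>\<^bsub>rat_ext A\<^esub> z \<oplus>\<^bsub>rat_ext A\<^esub> y \<otimes>\<^bsub>rat_ext A\<^esub> z"
    if "x \<in> carrier (rat_ext A)" "y \<in> carrier (rat_ext A)" "z \<in> carrier (rat_ext A)" for x y z
    using that
    by (elim rat_ext_cases) (simp add: frac_mult frac_add frac_eq_iff l_distr add_pow_simps mult_ac)
qed

end

sublocale Z_order \<subseteq> K: cring "rat_ext A"
  by (rule rat_ext_cring)

section \<open>The order inside its ring of fractions, and complex homomorphisms of both\<close>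

context Z_order
begin

lemma Units_rat_extI:
  assumes "x \<in> carrier (rat_ext A)" "y \<in> carrier (rat_ext A)" "x \<otimes>\<^bsub>rat_ext A\<^esub> y = \<one>\<^bsub>rat_ext A\<^esub>"
  shows "x \<in> Units (rat_ext A)"
  using assms K.m_comm[of y x] unfolding Units_def by auto

lemma of_order_hom: "of_order A \<in> ring_hom A (rat_ext A)"
  by (rule ring_hom_memI)
    (auto simp: of_order_def frac_mult frac_add rat_ext_one)

lemma of_order_closed [simp]: "a \<in> carrier A \<Longrightarrow> of_order A a \<in> carrier (rat_ext A)"
  by (simp add: of_order_def)

lemma of_order_mult: "a \<in> carrier A \<Longrightarrow> b \<in> carrier A \<Longrightarrow>
    of_order A (a \<otimes> b) = of_order A a \<otimes>\<^bsub>rat_ext A\<^esub> of_order A b"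
  using ring_hom_mult[OF of_order_hom] by simp

lemma of_order_add: "a \<in> carrier A \<Longrightarrow> b \<in> carrier A \<Longrightarrow>
    of_order A (a \<oplus> b) = of_order A a \<oplus>\<^bsub>rat_ext A\<^esub> of_order A b"
  using ring_hom_add[OF of_order_hom] by simp

lemma of_order_one: "of_order A \<one> = \<one>\<^bsub>rat_ext A\<^esub>"
  using ring_hom_one[OF of_order_hom] by simp

lemma of_order_zero: "of_order A \<zero> = \<zero>\<^bsub>rat_ext A\<^esub>"
  by (simp add: of_order_def rat_ext_zero)

lemma of_order_eq_frac:
  "a \<in> carrier A \<Longrightarrow> m \<noteq> 0 \<Longrightarrow> of_order A (add_pow A m \<one>) \<otimes>\<^bsub>rat_ext A\<^esub> frac A a m = of_order A a"
  by (simp add: of_order_def frac_mult frac_eq_iff add_pow_simps)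

lemma complex_hom_add_pow:
  assumes "\<psi> \<in> ring_hom A complex_ring" "a \<in> carrier A"
  shows "\<psi> (add_pow A (n::int) a) = of_int n * \<psi> a"
  by (rule additive_map_add_pow)
    (use assms ring_hom_add[OF assms(1)] in \<open>auto simp: ring_of_type_algebra_def\<close>)

text \<open>From n a = m b follows n \<psi>(a) = m \<psi>(b), so \<psi>(a)/m is independent of the
  representative and the image passed to \<open>the_elem\<close> is a singleton. Total positivity
  quantifies over homomorphisms of \<open>rat_ext A\<close>, separation of points over those of A;
  the extension links the two.\<close>

lemma extend_complex_hom:
  assumes "\<psi> \<in> ring_hom A complex_ring"
  shows "\<exists>\<chi>\<in>ring_hom (rat_ext A) complex_ring.
           \<forall>a\<in>carrier A. \<forall>m. m \<noteq> 0 \<longrightarrow> \<chi> (frac A a m) = \<psi> a / of_int m"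
proof -
  note hom = ring_hom_add[OF assms] ring_hom_mult[OF assms] ring_hom_one[OF assms]
  define \<chi> where "\<chi> = (\<lambda>P. the_elem ((\<lambda>(a, m). \<psi> a / of_int m) ` P))"
  have \<chi>: "\<chi> (frac A a m) = \<psi> a / of_int m" if "a \<in> carrier A" "m \<noteq> 0" for a m
  proof -
    have "(\<lambda>(a, m). \<psi> a / of_int m) ` frac A a m = {\<psi> a / of_int m}"
    proof -
      have eq: "(case p of (b, n) \<Rightarrow> \<psi> b / of_int n) = \<psi> a / of_int m" if p: "p \<in> frac A a m" for p
      proof -
        obtain b n where *: "p = (b, n)" "b \<in> carrier A" "n \<noteq> 0" "add_pow A n a = add_pow A m b"
          using p by (cases p) (auto simp: mem_frac_iff)
        then have "of_int n * \<psi> a = of_int m * \<psi> b"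
          using complex_hom_add_pow[OF assms] \<open>a \<in> carrier A\<close> by metis
        then show ?thesis using * \<open>m \<noteq> 0\<close> by (simp add: field_simps)
      qed
      have "(a, m) \<in> frac A a m" using that by (simp add: mem_frac_iff)
      moreover have "(\<lambda>(a, m). \<psi> a / of_int m) ` frac A a m = (\<lambda>_. \<psi> a / of_int m) ` frac A a m"
        by (rule image_cong[OF refl eq])
      ultimately show ?thesis by (simp only: image_constant)
    qed
    then show ?thesis by (simp add: \<chi>_def)
  qed
  have "\<chi> \<in> ring_hom (rat_ext A) complex_ring"
  proof (rule ring_hom_memI)
    show "\<chi> \<one>\<^bsub>rat_ext A\<^esub> = \<one>\<^bsub>complex_ring\<^esub>"
      using hom(3) by (simp add: rat_ext_one \<chi> ring_of_type_algebra_def)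
  next
    fix x y assume "x \<in> carrier (rat_ext A)" "y \<in> carrier (rat_ext A)"
    then obtain a m b n where *: "a \<in> carrier A" "m \<noteq> 0" "x = frac A a m"
      "b \<in> carrier A" "n \<noteq> 0" "y = frac A b n" by (auto simp: carrier_rat_ext_iff)
    then show "\<chi> (x \<otimes>\<^bsub>rat_ext A\<^esub> y) = \<chi> x \<otimes>\<^bsub>complex_ring\<^esub> \<chi> y"
      using hom(2)[of a b] by (simp add: frac_mult \<chi> ring_of_type_algebra_def)
    show "\<chi> (x \<oplus>\<^bsub>rat_ext A\<^esub> y) = \<chi> x \<oplus>\<^bsub>complex_ring\<^esub> \<chi> y"
    proof -
      have "\<psi> (add_pow A n a \<oplus> add_pow A m b) = of_int n * \<psi> a + of_int m * \<psi> b"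
        using * hom(1)[of "add_pow A n a" "add_pow A m b"]
        by (simp add: complex_hom_add_pow[OF assms] ring_of_type_algebra_def)
      then have "\<chi> (x \<oplus>\<^bsub>rat_ext A\<^esub> y) = (of_int n * \<psi> a + of_int m * \<psi> b) / of_int (m * n)"
        using * by (simp add: frac_add \<chi>)
      also have "\<dots> = \<chi> x + \<chi> y" using * by (simp add: \<chi> add_frac_eq mult.commute)
      finally show ?thesis by (simp add: ring_of_type_algebra_def)
    qed
  qed (simp add: ring_of_type_algebra_def)
  with \<chi> show ?thesis by blast
qed

lemma restrict_complex_hom:
  assumes "\<chi> \<in> ring_hom (rat_ext A) complex_ring"
  shows "(\<lambda>a. \<chi> (of_order A a)) \<in> ring_hom A complex_ring"
  using ring_hom_trans[OF of_order_hom assms] by (simp add: comp_def)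

lemma complex_hom_frac:
  assumes "\<chi> \<in> ring_hom (rat_ext A) complex_ring" "a \<in> carrier A" "m \<noteq> 0"
  shows "\<chi> (frac A a m) = \<chi> (of_order A a) / of_int m"
proof -
  have "\<chi> (of_order A a) = \<chi> (of_order A (add_pow A m \<one>) \<otimes>\<^bsub>rat_ext A\<^esub> frac A a m)"
    using assms by (simp add: of_order_eq_frac)
  also have "\<dots> = \<chi> (of_order A (add_pow A m \<one>)) * \<chi> (frac A a m)"
    using ring_hom_mult[OF assms(1)] assms by (simp add: ring_of_type_algebra_def)
  also have "\<chi> (of_order A (add_pow A m \<one>)) = of_int m * \<chi> (of_order A \<one>)"
    by (rule complex_hom_add_pow[OF restrict_complex_hom[OF assms(1)]]) simp
  also have "\<chi> (of_order A \<one>) = 1"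
    using ring_hom_one[OF assms(1)] by (simp add: of_order_one ring_of_type_algebra_def)
  finally show ?thesis using assms by (simp add: field_simps)
qed

end

section \<open>Conjugation and total positivity for fractions\<close>

context CM_order
begin

lemma bar_hom: "bar \<in> ring_hom A A"
  using bar_automorphism by (simp add: ring_iso_def)

lemma bar_add_pow: "a \<in> carrier A \<Longrightarrow> bar (add_pow A (n::int) a) = add_pow A n (bar a)"
  by (rule complex_homs_separate) (simp_all add: bar_cnj complex_hom_add_pow)

lemma bar_ext_frac:
  assumes "a \<in> carrier A" "m \<noteq> 0"
  shows "bar_ext A bar (frac A a m) = frac A (bar a) m"
  unfolding bar_ext_def
  by (rule UN_frac) (use assms bar_add_pow in \<open>auto simp: frac_eq_iff, metis\<close>)

lemma bar_ext_hom: "bar_ext A bar \<in> ring_hom (rat_ext A) (rat_ext A)"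
  using ring_hom_add[OF bar_hom] ring_hom_mult[OF bar_hom] ring_hom_one[OF bar_hom]
  by (intro ring_hom_memI)
    (auto simp: frac_mult frac_add bar_ext_frac rat_ext_one bar_add_pow elim!: rat_ext_cases)

lemma bar_ext_closed [simp]: "x \<in> carrier (rat_ext A) \<Longrightarrow> bar_ext A bar x \<in> carrier (rat_ext A)"
  using ring_hom_closed[OF bar_ext_hom] .

lemma bar_ext_mult: "x \<in> carrier (rat_ext A) \<Longrightarrow> y \<in> carrier (rat_ext A) \<Longrightarrow>
    bar_ext A bar (x \<otimes>\<^bsub>rat_ext A\<^esub> y) = bar_ext A bar x \<otimes>\<^bsub>rat_ext A\<^esub> bar_ext A bar y"
  using ring_hom_mult[OF bar_ext_hom] by simp

lemma bar_ext_add: "x \<in> carrier (rat_ext A) \<Longrightarrow> y \<in> carrier (rat_ext A) \<Longrightarrow>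
    bar_ext A bar (x \<oplus>\<^bsub>rat_ext A\<^esub> y) = bar_ext A bar x \<oplus>\<^bsub>rat_ext A\<^esub> bar_ext A bar y"
  using ring_hom_add[OF bar_ext_hom] by simp

lemma bar_ext_one: "bar_ext A bar \<one>\<^bsub>rat_ext A\<^esub> = \<one>\<^bsub>rat_ext A\<^esub>"
  using ring_hom_one[OF bar_ext_hom] .

lemma bar_ext_of_order: "a \<in> carrier A \<Longrightarrow> bar_ext A bar (of_order A a) = of_order A (bar a)"
  by (simp add: of_order_def bar_ext_frac)

lemma bar_ext_bar_ext [simp]: "x \<in> carrier (rat_ext A) \<Longrightarrow> bar_ext A bar (bar_ext A bar x) = x"
  by (auto simp: carrier_rat_ext_iff bar_ext_frac)

lemma bar_ext_Units: "v \<in> Units (rat_ext A) \<Longrightarrow> bar_ext A bar v \<in> Units (rat_ext A)"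
  using bar_ext_mult[of v "inv\<^bsub>rat_ext A\<^esub> v"]
  by (intro Units_rat_extI[of _ "bar_ext A bar (inv\<^bsub>rat_ext A\<^esub> v)"])
    (auto simp: bar_ext_one K.Units_closed)

lemma bar_ext_cnj:
  assumes "\<chi> \<in> ring_hom (rat_ext A) complex_ring" "x \<in> carrier (rat_ext A)"
  shows "\<chi> (bar_ext A bar x) = cnj (\<chi> x)"
  using assms bar_cnj[OF restrict_complex_hom[OF assms(1)]]
  by (auto simp: carrier_rat_ext_iff bar_ext_frac complex_hom_frac[OF assms(1)])

lemma totally_positive_closed: "w \<in> totally_positive A \<Longrightarrow> w \<in> carrier (rat_ext A)"
  by (simp add: totally_positive_def)

lemma totally_positive_value:
  assumes "w \<in> totally_positive A" "\<chi> \<in> ring_hom (rat_ext A) complex_ring"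
  obtains r where "\<chi> w = complex_of_real r" "r > 0"
  using assms that by (auto simp: totally_positive_def)

lemma totally_positive_one: "\<one>\<^bsub>rat_ext A\<^esub> \<in> totally_positive A"
proof -
  have "\<chi> \<one>\<^bsub>rat_ext A\<^esub> = complex_of_real 1" if "\<chi> \<in> ring_hom (rat_ext A) complex_ring" for \<chi>
    using ring_hom_one[OF that] by (simp add: ring_of_type_algebra_def)
  then show ?thesis unfolding totally_positive_def by (auto intro!: image_eqI[of _ _ 1])
qed

lemma totally_positive_mult:
  assumes "w \<in> totally_positive A" "u \<in> totally_positive A"
  shows "w \<otimes>\<^bsub>rat_ext A\<^esub> u \<in> totally_positive A"
proof -
  have "\<chi> (w \<otimes>\<^bsub>rat_ext A\<^esub> u) \<in> complex_of_real ` {0<..}"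
    if \<chi>: "\<chi> \<in> ring_hom (rat_ext A) complex_ring" for \<chi>
  proof -
    obtain r s where "\<chi> w = complex_of_real r" "\<chi> u = complex_of_real s" "r > 0" "s > 0"
      using assms \<chi> by (fastforce simp: totally_positive_def)
    moreover have "\<chi> (w \<otimes>\<^bsub>rat_ext A\<^esub> u) = \<chi> w * \<chi> u"
      using ring_hom_mult[OF \<chi>] assms by (simp add: ring_of_type_algebra_def totally_positive_def)
    ultimately show ?thesis by (auto intro!: image_eqI[of _ _ "r * s"])
  qed
  then show ?thesis using assms by (simp add: totally_positive_def)
qed

lemma complex_hom_inv:
  assumes \<chi>: "\<chi> \<in> ring_hom (rat_ext A) complex_ring" and v: "v \<in> Units (rat_ext A)"
  shows "\<chi> v * \<chi> (inv\<^bsub>rat_ext A\<^esub> v) = 1"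
proof -
  have "\<chi> v * \<chi> (inv\<^bsub>rat_ext A\<^esub> v) = \<chi> (v \<otimes>\<^bsub>rat_ext A\<^esub> inv\<^bsub>rat_ext A\<^esub> v)"
    using ring_hom_mult[OF \<chi>, of v "inv\<^bsub>rat_ext A\<^esub> v"] v
    by (simp add: ring_of_type_algebra_def K.Units_closed del: K.Units_r_inv)
  also have "\<dots> = 1" using ring_hom_one[OF \<chi>] v by (simp add: ring_of_type_algebra_def)
  finally show ?thesis .
qed

lemma totally_positive_inv:
  assumes "w \<in> totally_positive A" "w \<in> Units (rat_ext A)"
  shows "inv\<^bsub>rat_ext A\<^esub> w \<in> totally_positive A"
proof -
  have "\<chi> (inv\<^bsub>rat_ext A\<^esub> w) \<in> complex_of_real ` {0<..}"
    if \<chi>: "\<chi> \<in> ring_hom (rat_ext A) complex_ring" for \<chi>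
  proof -
    obtain r where "\<chi> w = complex_of_real r" "r > 0"
      using assms \<chi> by (fastforce simp: totally_positive_def)
    with complex_hom_inv[OF \<chi> assms(2)] have "\<chi> (inv\<^bsub>rat_ext A\<^esub> w) = complex_of_real (1 / r)"
      by (simp add: field_simps)
    with \<open>r > 0\<close> show ?thesis by (auto intro!: image_eqI[of _ _ "1 / r"])
  qed
  then show ?thesis using assms by (simp add: totally_positive_def)
qed

text \<open>The value under \<chi> is the squared modulus of \<chi>(v), and \<chi>(v) \<noteq> 0
  because v is a unit.\<close>

lemma totally_positive_norm:
  assumes "v \<in> Units (rat_ext A)"
  shows "v \<otimes>\<^bsub>rat_ext A\<^esub> bar_ext A bar v \<in> totally_positive A"
proof -
  have v: "v \<in> carrier (rat_ext A)" using assms by (rule K.Units_closed)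
  have "\<chi> (v \<otimes>\<^bsub>rat_ext A\<^esub> bar_ext A bar v) \<in> complex_of_real ` {0<..}"
    if \<chi>: "\<chi> \<in> ring_hom (rat_ext A) complex_ring" for \<chi>
  proof -
    have "\<chi> (v \<otimes>\<^bsub>rat_ext A\<^esub> bar_ext A bar v) = \<chi> v * cnj (\<chi> v)"
      using ring_hom_mult[OF \<chi>] v by (simp add: ring_of_type_algebra_def bar_ext_cnj[OF \<chi>])
    also have "\<dots> = complex_of_real ((cmod (\<chi> v))\<^sup>2)"
      using complex_norm_square[of "\<chi> v"] by simp
    finally have eq: "\<chi> (v \<otimes>\<^bsub>rat_ext A\<^esub> bar_ext A bar v) = complex_of_real ((cmod (\<chi> v))\<^sup>2)" .
    have "\<chi> v \<noteq> 0" using complex_hom_inv[OF \<chi> assms] by auto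
    then show ?thesis unfolding eq by (intro imageI) simp
  qed
  then show ?thesis using v by (simp add: totally_positive_def)
qed

text \<open>Write w = a/m. Every \<psi> on A extends to fractions, where its value at w is real;
  hence \<psi>(a) is real and equals \<psi>(bar a). Separation of points gives bar a = a.\<close>

lemma totally_positive_real:
  assumes "w \<in> totally_positive A"
  shows "bar_ext A bar w = w"
proof -
  obtain a m where a: "a \<in> carrier A" "m \<noteq> 0" "w = frac A a m"
    using totally_positive_closed[OF assms] by (auto simp: carrier_rat_ext_iff)
  have "bar a = a"
  proof (rule complex_homs_separate)
    fix \<psi> assume \<psi>: "\<psi> \<in> ring_hom A complex_ring"
    then obtain \<chi> where \<chi>: "\<chi> \<in> ring_hom (rat_ext A) complex_ring" "\<chi> w = \<psi> a / of_int m"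
      using extend_complex_hom a by blast
    obtain r where "\<chi> w = complex_of_real r"
      using totally_positive_value[OF assms \<chi>(1)] by blast
    with \<chi>(2) have "\<psi> a / of_int m = complex_of_real r" by simp
    then have "\<psi> a = complex_of_real (r * of_int m)" using a by (simp add: field_simps)
    then show "\<psi> (bar a) = \<psi> a" using bar_cnj[OF \<psi> a(1)] by simp
  qed (use a in auto)
  then show ?thesis using a by (simp add: bar_ext_frac)
qed

end

section \<open>The group of invertible ideals\<close>

text \<open>One criterion for both scalar rings that occur, A for ideals and \<rat> for the spanning
  condition.\<close>

lemma (in abelian_group) submodule_module_via_iff:
  "submodule M R (module_via G f) \<longleftrightarrow>
     M \<subseteq> carrier G \<and> \<zero> \<in> M \<and> (\<forall>x\<in>M. \<forall>y\<in>M. x \<oplus> y \<in> M) \<and> (\<forall>x\<in>M. \<ominus> x \<in> M) \<and>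
     (\<forall>a\<in>carrier R. \<forall>x\<in>M. f a \<otimes> x \<in> M)"
proof -
  have "inv\<^bsub>add_monoid (module_via G f)\<^esub> x = \<ominus> x" for x
    by (simp add: a_inv_def m_inv_def module_via_def)
  then show ?thesis
    unfolding submodule_def submodule_axioms_def subgroup_def
    by (auto simp: module_via_def)
qed

context Z_order
begin

abbreviation order_submodule :: "('a \<times> int) set set \<Rightarrow> bool"
  where "order_submodule M \<equiv> submodule M A (module_via (rat_ext A) (of_order A))"

text \<open>Closure under negation comes from the scalar -1.\<close>

lemma order_submodule_iff:
  "order_submodule M \<longleftrightarrow>
     M \<subseteq> carrier (rat_ext A) \<and> \<zero>\<^bsub>rat_ext A\<^esub> \<in> M \<and>
     (\<forall>x\<in>M. \<forall>y\<in>M. x \<oplus>\<^bsub>rat_ext A\<^esub> y \<in> M) \<and>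
     (\<forall>a\<in>carrier A. \<forall>x\<in>M. of_order A a \<otimes>\<^bsub>rat_ext A\<^esub> x \<in> M)"
proof -
  have "\<ominus>\<^bsub>rat_ext A\<^esub> x = of_order A (\<ominus> \<one>) \<otimes>\<^bsub>rat_ext A\<^esub> x" if "x \<in> carrier (rat_ext A)" for x
  proof -
    have "of_order A (\<ominus> \<one>) \<oplus>\<^bsub>rat_ext A\<^esub> \<one>\<^bsub>rat_ext A\<^esub> = \<zero>\<^bsub>rat_ext A\<^esub>"
      using of_order_add[of "\<ominus> \<one>" \<one>] by (simp add: l_neg of_order_zero of_order_one)
    then have "of_order A (\<ominus> \<one>) = \<ominus>\<^bsub>rat_ext A\<^esub> \<one>\<^bsub>rat_ext A\<^esub>"
      by (intro K.minus_equality[symmetric]) auto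
    then show ?thesis using that by (simp add: K.l_minus)
  qed
  then have "(\<forall>x\<in>M. \<ominus>\<^bsub>rat_ext A\<^esub> x \<in> M)"
    if "M \<subseteq> carrier (rat_ext A)" "\<forall>a\<in>carrier A. \<forall>x\<in>M. of_order A a \<otimes>\<^bsub>rat_ext A\<^esub> x \<in> M"
    using that add.inv_closed[OF one_closed] by (auto simp: subset_iff)
  then show ?thesis unfolding K.submodule_module_via_iff by blast
qed

lemma order_submodule_carrier: "order_submodule (carrier (rat_ext A))"
  by (simp add: order_submodule_iff)

lemma order_submodule_closed: "order_submodule M \<Longrightarrow> M \<subseteq> carrier (rat_ext A)"
  by (simp add: order_submodule_iff)

lemma order_span_submodule:
  assumes "S \<subseteq> carrier (rat_ext A)"
  shows "order_submodule (order_span A S)"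
proof -
  have mem: "x \<in> order_span A S \<longleftrightarrow> (\<forall>t. order_submodule t \<longrightarrow> S \<subseteq> t \<longrightarrow> x \<in> t)" for x
    by (auto simp: order_span_def hull_def)
  show ?thesis
    unfolding order_submodule_iff[of "order_span A S"]
  proof (intro conjI ballI)
    \<comment> \<open>The carrier is itself one of the submodules over which the hull takes the
      intersection.\<close>
    show "order_span A S \<subseteq> carrier (rat_ext A)"
      using order_submodule_carrier assms by (auto simp: mem)
    show "\<zero>\<^bsub>rat_ext A\<^esub> \<in> order_span A S" by (simp add: mem order_submodule_iff)
  qed (simp_all add: mem order_submodule_iff)
qed

lemma order_span_closed: "S \<subseteq> carrier (rat_ext A) \<Longrightarrow> order_span A S \<subseteq> carrier (rat_ext A)"
  using order_span_submodule order_submodule_closed by blast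

lemma order_span_minimal: "S \<subseteq> M \<Longrightarrow> order_submodule M \<Longrightarrow> order_span A S \<subseteq> M"
  unfolding order_span_def by (rule hull_minimal)

lemma order_span_superset: "S \<subseteq> order_span A S"
  unfolding order_span_def by (rule hull_subset)

lemma order_span_same: "order_submodule M \<Longrightarrow> order_span A M = M"
  unfolding order_span_def by (rule hull_same)

lemma order_span_eqI:
  assumes "S \<subseteq> carrier (rat_ext A)" "T \<subseteq> carrier (rat_ext A)"
    and "S \<subseteq> order_span A T" "T \<subseteq> order_span A S"
  shows "order_span A S = order_span A T"
  using assms order_span_minimal order_span_submodule by (metis subset_antisym)

section \<open>Multiplication of spans\<close>

abbreviation products ::
    "('a \<times> int) set set \<Rightarrow> ('a \<times> int) set set \<Rightarrow> ('a \<times> int) set set"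
  where "products S T \<equiv> {x \<otimes>\<^bsub>rat_ext A\<^esub> y | x y. x \<in> S \<and> y \<in> T}"

lemma products_closed: "S \<subseteq> carrier (rat_ext A) \<Longrightarrow> T \<subseteq> carrier (rat_ext A) \<Longrightarrow>
    products S T \<subseteq> carrier (rat_ext A)"
  by (auto simp: subset_iff)

lemma products_commute:
  assumes "S \<subseteq> carrier (rat_ext A)" "T \<subseteq> carrier (rat_ext A)"
  shows "products S T = products T S"
  using assms K.m_comm by (auto simp: subset_iff) metis+

lemma products_assoc:
  assumes "S \<subseteq> carrier (rat_ext A)" "T \<subseteq> carrier (rat_ext A)" "U \<subseteq> carrier (rat_ext A)"
  shows "products (products S T) U = products S (products T U)"
proof -
  have "x \<otimes>\<^bsub>rat_ext A\<^esub> y \<otimes>\<^bsub>rat_ext A\<^esub> z = x \<otimes>\<^bsub>rat_ext A\<^esub> (y \<otimes>\<^bsub>rat_ext A\<^esub> z)"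
    if "x \<in> S" "y \<in> T" "z \<in> U" for x y z
    using that assms by (intro K.m_assoc) auto
  then show ?thesis by (auto, metis+)
qed

text \<open>The elements x whose products with all of \<open>T\<close> lie in the span of the
  products form a submodule. It contains \<open>S\<close>, hence the span of \<open>S\<close>. This
  is what makes ideal multiplication computable on generators and associative.\<close>

lemma order_span_products_left:
  assumes S: "S \<subseteq> carrier (rat_ext A)" and T: "T \<subseteq> carrier (rat_ext A)"
  shows "order_span A (products (order_span A S) T) = order_span A (products S T)"
proof (rule order_span_eqI)
  let ?N = "order_span A (products S T)"
  have N: "order_submodule ?N" using products_closed[OF S T] by (rule order_span_submodule)
  let ?X = "{x\<in>carrier (rat_ext A). \<forall>y\<in>T. x \<otimes>\<^bsub>rat_ext A\<^esub> y \<in> ?N}"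
  have "order_submodule ?X"
    unfolding order_submodule_iff
  proof (intro conjI ballI)
    show "\<zero>\<^bsub>rat_ext A\<^esub> \<in> ?X" using N T by (auto simp: order_submodule_iff subset_iff)
  next
    fix x x' assume "x \<in> ?X" "x' \<in> ?X"
    then show "x \<oplus>\<^bsub>rat_ext A\<^esub> x' \<in> ?X"
      using N T by (auto simp: order_submodule_iff K.l_distr subset_iff)
  next
    fix a x assume "a \<in> carrier A" "x \<in> ?X"
    then show "of_order A a \<otimes>\<^bsub>rat_ext A\<^esub> x \<in> ?X"
      using N T by (auto simp: order_submodule_iff K.m_assoc subset_iff)
  qed auto
  moreover have "S \<subseteq> ?X"
    using S order_span_superset[of "products S T"] by auto
  ultimately have "order_span A S \<subseteq> ?X"
    by (intro order_span_minimal)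
  then show "products (order_span A S) T \<subseteq> ?N" by auto
  have "products S T \<subseteq> products (order_span A S) T" using order_span_superset[of S] by blast
  then show "products S T \<subseteq> order_span A (products (order_span A S) T)"
    by (rule order_trans[OF _ order_span_superset])
  show "products (order_span A S) T \<subseteq> carrier (rat_ext A)" "products S T \<subseteq> carrier (rat_ext A)"
    using products_closed order_span_closed S T by simp_all
qed

lemma order_span_products_right:
  assumes "S \<subseteq> carrier (rat_ext A)" "T \<subseteq> carrier (rat_ext A)"
  shows "order_span A (products S (order_span A T)) = order_span A (products S T)"
  using assms order_span_products_left[of T S] order_span_closed[of T]
    products_commute[of S T] products_commute[of S "order_span A T"] by simp

lemma frac_ideal_mult_span:
  assumes "S \<subseteq> carrier (rat_ext A)" "T \<subseteq> carrier (rat_ext A)"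
  shows "frac_ideal_mult A (order_span A S) (order_span A T) = order_span A (products S T)"
  using assms order_span_closed[of T]
  by (simp add: frac_ideal_mult_def order_span_products_left order_span_products_right)

lemma frac_ideal_mult_commute:
  assumes "I \<subseteq> carrier (rat_ext A)" "J \<subseteq> carrier (rat_ext A)"
  shows "frac_ideal_mult A I J = frac_ideal_mult A J I"
  using products_commute[OF assms] by (simp add: frac_ideal_mult_def)

lemma frac_ideal_mult_assoc:
  assumes "I \<subseteq> carrier (rat_ext A)" "J \<subseteq> carrier (rat_ext A)" "L \<subseteq> carrier (rat_ext A)"
  shows "frac_ideal_mult A (frac_ideal_mult A I J) L = frac_ideal_mult A I (frac_ideal_mult A J L)"
  unfolding frac_ideal_mult_def
  using products_assoc[OF assms] products_closed[OF assms(1,2)] products_closed[OF assms(2,3)] assms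
  by (simp only: order_span_products_left order_span_products_right)

text \<open>Brings principal ideals into the calculus of spans, where their products and conjugates
  reduce to those of a single generator.\<close>

lemma order_multiples_eq_span:
  assumes "v \<in> carrier (rat_ext A)"
  shows "order_multiples A v = order_span A {v}"
proof
  have "order_submodule (order_multiples A v)"
    unfolding order_submodule_iff order_multiples_def
  proof (intro conjI ballI)
    show "\<zero>\<^bsub>rat_ext A\<^esub> \<in> (\<lambda>a. of_order A a \<otimes>\<^bsub>rat_ext A\<^esub> v) ` carrier A"
      using assms by (intro image_eqI[of _ _ \<zero>]) (auto simp: of_order_zero)
  next
    fix x y assume "x \<in> (\<lambda>a. of_order A a \<otimes>\<^bsub>rat_ext A\<^esub> v) ` carrier A"
      "y \<in> (\<lambda>a. of_order A a \<otimes>\<^bsub>rat_ext A\<^esub> v) ` carrier A"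
    then show "x \<oplus>\<^bsub>rat_ext A\<^esub> y \<in> (\<lambda>a. of_order A a \<otimes>\<^bsub>rat_ext A\<^esub> v) ` carrier A"
      using assms by (auto simp: K.l_distr[symmetric] of_order_add[symmetric])
  next
    fix b x assume "b \<in> carrier A" "x \<in> (\<lambda>a. of_order A a \<otimes>\<^bsub>rat_ext A\<^esub> v) ` carrier A"
    then show "of_order A b \<otimes>\<^bsub>rat_ext A\<^esub> x \<in> (\<lambda>a. of_order A a \<otimes>\<^bsub>rat_ext A\<^esub> v) ` carrier A"
      using assms by (auto simp: K.m_assoc[symmetric] of_order_mult[symmetric])
  qed (use assms in auto)
  moreover have "v \<in> order_multiples A v"
    using assms unfolding order_multiples_def
    by (intro image_eqI[of _ _ \<one>]) (auto simp: of_order_one)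
  ultimately show "order_span A {v} \<subseteq> order_multiples A v"
    by (intro order_span_minimal) auto
  have "order_submodule (order_span A {v})" using assms by (intro order_span_submodule) auto
  then show "order_multiples A v \<subseteq> order_span A {v}"
    using order_span_superset[of "{v}"] by (auto simp: order_multiples_def order_submodule_iff)
qed

lemma frac_ideal_mult_multiples:
  assumes "v \<in> carrier (rat_ext A)" "w \<in> carrier (rat_ext A)"
  shows "frac_ideal_mult A (order_multiples A v) (order_multiples A w) =
    order_multiples A (v \<otimes>\<^bsub>rat_ext A\<^esub> w)"
  using assms frac_ideal_mult_span[of "{v}" "{w}"] by (simp add: order_multiples_eq_span)

lemma order_multiples_one: "order_multiples A \<one>\<^bsub>rat_ext A\<^esub> = of_order A ` carrier A"
  by (auto simp: order_multiples_def)

lemma frac_ideal_mult_one: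
  assumes "order_submodule I"
  shows "frac_ideal_mult A (of_order A ` carrier A) I = I"
proof -
  have I: "I \<subseteq> carrier (rat_ext A)" using assms by (rule order_submodule_closed)
  have "frac_ideal_mult A (of_order A ` carrier A) I =
      frac_ideal_mult A (order_span A {\<one>\<^bsub>rat_ext A\<^esub>}) (order_span A I)"
    by (simp add: order_span_same[OF assms] order_multiples_eq_span[symmetric] order_multiples_one)
  also have "\<dots> = order_span A (products {\<one>\<^bsub>rat_ext A\<^esub>} I)"
    using I by (intro frac_ideal_mult_span) auto
  also have "products {\<one>\<^bsub>rat_ext A\<^esub>} I = (\<lambda>y. \<one>\<^bsub>rat_ext A\<^esub> \<otimes>\<^bsub>rat_ext A\<^esub> y) ` I" by auto
  also have "\<dots> = (\<lambda>y. y) ` I" by (rule image_cong) (use I in auto)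
  finally show ?thesis using order_span_same[OF assms] by simp
qed

section \<open>Fractional ideals and the rational spanning condition\<close>

abbreviation int_elem :: "int \<Rightarrow> ('a \<times> int) set"
  where "int_elem n \<equiv> of_order A (add_pow A n \<one>)"

lemma int_elem_mult: "int_elem (m * n) = int_elem m \<otimes>\<^bsub>rat_ext A\<^esub> int_elem n"
  by (simp add: of_order_mult[symmetric] add_pow_simps mult.commute)

lemma rat_scalar_closed: "rat_scalar A q \<in> carrier (rat_ext A)"
  using quotient_of_denom_pos'[of q] by (auto simp: rat_scalar_def)

text \<open>Trades the hull over \<rat> for a single witness, a non-zero integer in the ideal. If
  the span is everything, clearing the denominators of 1 yields the integer; conversely, n \<in> I
  gives a/m as the rational multiple 1/(m n) of a n \<in> I.\<close>

lemma rat_span_eq_carrier_iff: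
  assumes I: "order_submodule I"
  shows "rat_span A I = carrier (rat_ext A) \<longleftrightarrow> (\<exists>n. n \<noteq> 0 \<and> int_elem n \<in> I)"
proof
  let ?Q = "\<lambda>M. submodule M rat_ring (module_via (rat_ext A) (rat_scalar A))"
  note Q_iff = K.submodule_module_via_iff[where R = rat_ring and f = "rat_scalar A"]
  {
    assume span: "rat_span A I = carrier (rat_ext A)"
    \<comment> \<open>The elements that some non-zero integer moves into I. They form a
      \<rat>-submodule containing I, hence contain its rational span.\<close>
    define T where "T = {x\<in>carrier (rat_ext A). \<exists>n. n \<noteq> 0 \<and> int_elem n \<otimes>\<^bsub>rat_ext A\<^esub> x \<in> I}"
    have "?Q T"
      unfolding Q_iff
    proof (intro conjI ballI)
      show "T \<subseteq> carrier (rat_ext A)" by (auto simp: T_def)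
      show "\<zero>\<^bsub>rat_ext A\<^esub> \<in> T"
        using I by (auto simp: T_def order_submodule_iff intro!: exI[of _ 1])
    next
      fix x y assume "x \<in> T" "y \<in> T"
      then obtain m n where *: "x \<in> carrier (rat_ext A)" "y \<in> carrier (rat_ext A)" "m \<noteq> 0" "n \<noteq> 0"
        "int_elem m \<otimes>\<^bsub>rat_ext A\<^esub> x \<in> I" "int_elem n \<otimes>\<^bsub>rat_ext A\<^esub> y \<in> I" by (auto simp: T_def)
      have "int_elem (m * n) \<otimes>\<^bsub>rat_ext A\<^esub> (x \<oplus>\<^bsub>rat_ext A\<^esub> y) =
          int_elem n \<otimes>\<^bsub>rat_ext A\<^esub> (int_elem m \<otimes>\<^bsub>rat_ext A\<^esub> x) \<oplus>\<^bsub>rat_ext A\<^esub>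
          int_elem m \<otimes>\<^bsub>rat_ext A\<^esub> (int_elem n \<otimes>\<^bsub>rat_ext A\<^esub> y)"
        using * by (simp add: int_elem_mult K.r_distr) (simp add: K.m_ac)
      also have "\<dots> \<in> I" using I * by (simp add: order_submodule_iff)
      finally show "x \<oplus>\<^bsub>rat_ext A\<^esub> y \<in> T" using * by (auto simp: T_def intro!: exI[of _ "m * n"])
    next
      fix x assume "x \<in> T"
      then obtain m where *: "x \<in> carrier (rat_ext A)" "m \<noteq> 0" "int_elem m \<otimes>\<^bsub>rat_ext A\<^esub> x \<in> I"
        by (auto simp: T_def)
      have "int_elem m \<otimes>\<^bsub>rat_ext A\<^esub> (\<ominus>\<^bsub>rat_ext A\<^esub> x) = \<ominus>\<^bsub>rat_ext A\<^esub> (int_elem m \<otimes>\<^bsub>rat_ext A\<^esub> x)"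
        using * by (simp add: K.r_minus)
      also have "\<dots> \<in> I" using I * by (simp add: K.submodule_module_via_iff)
      finally show "\<ominus>\<^bsub>rat_ext A\<^esub> x \<in> T" using * by (auto simp: T_def)
    next
      fix q x assume "x \<in> T"
      then obtain m where *: "x \<in> carrier (rat_ext A)" "m \<noteq> 0" "int_elem m \<otimes>\<^bsub>rat_ext A\<^esub> x \<in> I"
        by (auto simp: T_def)
      obtain r d where q: "quotient_of q = (r, d)" by (cases "quotient_of q") auto
      then have "d \<noteq> 0" using quotient_of_denom_pos[OF q] by simp
      have "int_elem d \<otimes>\<^bsub>rat_ext A\<^esub> rat_scalar A q = int_elem r"
        using \<open>d \<noteq> 0\<close> q by (simp add: rat_scalar_def of_order_eq_frac)
      then have "int_elem (m * d) \<otimes>\<^bsub>rat_ext A\<^esub> (rat_scalar A q \<otimes>\<^bsub>rat_ext A\<^esub> x) =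
          int_elem r \<otimes>\<^bsub>rat_ext A\<^esub> (int_elem m \<otimes>\<^bsub>rat_ext A\<^esub> x)"
        using * rat_scalar_closed[of q]
        by (simp add: int_elem_mult K.m_assoc K.m_lcomm[of "int_elem r" "int_elem m" x]
            flip: K.m_assoc[of "int_elem d" "rat_scalar A q" x])
      also have "\<dots> \<in> I" using I * by (simp add: order_submodule_iff)
      finally show "rat_scalar A q \<otimes>\<^bsub>rat_ext A\<^esub> x \<in> T"
        using * \<open>d \<noteq> 0\<close> rat_scalar_closed[of q] by (auto simp: T_def intro!: exI[of _ "m * d"])
    qed
    moreover have "I \<subseteq> T"
      using order_submodule_closed[OF I] by (auto simp: T_def of_order_one intro!: exI[of _ 1])
    ultimately have "rat_span A I \<subseteq> T" unfolding rat_span_def by (intro hull_minimal)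
    then have "\<one>\<^bsub>rat_ext A\<^esub> \<in> T" using span by auto
    then show "\<exists>n. n \<noteq> 0 \<and> int_elem n \<in> I" by (auto simp: T_def)
  }
  {
    assume "\<exists>n. n \<noteq> 0 \<and> int_elem n \<in> I"
    then obtain n where n: "n \<noteq> 0" "int_elem n \<in> I" by blast
    show "rat_span A I = carrier (rat_ext A)"
    proof
      have "?Q (carrier (rat_ext A))" unfolding Q_iff using rat_scalar_closed by auto
      then show "rat_span A I \<subseteq> carrier (rat_ext A)"
        unfolding rat_span_def using order_submodule_closed[OF I] by (intro hull_minimal)
      have "x \<in> t" if x: "x \<in> carrier (rat_ext A)" and t: "?Q t" "I \<subseteq> t" for x t
      proof -
        obtain a m where a: "a \<in> carrier A" "m \<noteq> 0" "x = frac A a m" using x by (elim rat_ext_cases)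
        \<comment> \<open>The normal form of q has a positive denominator, so the sign of m n ends
          up in the numerator r; hence the relation r (m n) = d below instead of d = m n.\<close>
        define q where "q = 1 / (of_int (m * n) :: rat)"
        obtain r d where q: "quotient_of q = (r, d)" by (cases "quotient_of q") auto
        have d: "d > 0" using quotient_of_denom_pos[OF q] .
        have "of_int r / of_int d = 1 / (of_int (m * n) :: rat)"
          using quotient_of_div[OF q] by (simp add: q_def)
        then have "of_int (r * (m * n)) = (of_int d :: rat)"
          using a n d by (simp add: field_simps)
        then have rd: "r * (m * n) = d" by (simp only: of_int_eq_iff)
        have "of_order A a \<otimes>\<^bsub>rat_ext A\<^esub> int_elem n \<in> I"
          using I a n by (simp add: order_submodule_iff)
        then have "rat_scalar A q \<otimes>\<^bsub>rat_ext A\<^esub> (of_order A a \<otimes>\<^bsub>rat_ext A\<^esub> int_elem n) \<in> t"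
          using t(2) t(1)[unfolded Q_iff] by (auto simp: ring_of_type_algebra_def)
        moreover have "rat_scalar A q \<otimes>\<^bsub>rat_ext A\<^esub> (of_order A a \<otimes>\<^bsub>rat_ext A\<^esub> int_elem n) =
            frac A (add_pow A (r * n) a) d"
          using a d q by (simp add: rat_scalar_def of_order_def frac_mult add_pow_simps)
        moreover have "\<dots> = x"
          using a d rd by (simp add: frac_eq_iff add.int_pow_pow mult_ac)
        ultimately show ?thesis by simp
      qed
      then show "carrier (rat_ext A) \<subseteq> rat_span A I" unfolding rat_span_def hull_def by auto
    qed
  }
qed

lemma fractional_ideal_iff:
  "fractional_ideal A I \<longleftrightarrow>
     (\<exists>S. finite S \<and> S \<subseteq> carrier (rat_ext A) \<and> I = order_span A S) \<and>
     (\<exists>n. n \<noteq> 0 \<and> int_elem n \<in> I)"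
  unfolding fractional_ideal_def using order_span_submodule rat_span_eq_carrier_iff by metis

lemma fractional_ideal_submodule: "fractional_ideal A I \<Longrightarrow> order_submodule I"
  by (simp add: fractional_ideal_def)

lemma fractional_ideal_closed: "fractional_ideal A I \<Longrightarrow> I \<subseteq> carrier (rat_ext A)"
  using fractional_ideal_submodule order_submodule_closed by blast

lemma fractional_ideal_mult:
  assumes "fractional_ideal A I" "fractional_ideal A J"
  shows "fractional_ideal A (frac_ideal_mult A I J)"
proof -
  obtain S T where S: "finite S" "S \<subseteq> carrier (rat_ext A)" "I = order_span A S"
    and T: "finite T" "T \<subseteq> carrier (rat_ext A)" "J = order_span A T"
    using assms by (auto simp: fractional_ideal_iff)
  have "products S T = (\<lambda>(x, y). x \<otimes>\<^bsub>rat_ext A\<^esub> y) ` (S \<times> T)" by auto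
  then have "finite (products S T)" using S T by simp
  moreover have "frac_ideal_mult A I J = order_span A (products S T)"
    using S T by (simp add: frac_ideal_mult_span)
  moreover obtain m n where mn: "m \<noteq> 0" "n \<noteq> 0" "int_elem m \<in> I" "int_elem n \<in> J"
    using assms by (auto simp: fractional_ideal_iff)
  then have "int_elem (m * n) \<in> products I J" unfolding int_elem_mult by blast
  then have "int_elem (m * n) \<in> frac_ideal_mult A I J"
    unfolding frac_ideal_mult_def by (rule subsetD[OF order_span_superset])
  ultimately show ?thesis
    unfolding fractional_ideal_iff using products_closed[OF S(2) T(2)] mn
    by (intro conjI exI[of _ "products S T"] exI[of _ "m * n"]) auto
qed

text \<open>If the inverse of v is b/k, then b v = k is the non-zero integer in Av.\<close>

lemma fractional_ideal_multiples:
  assumes "v \<in> Units (rat_ext A)"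
  shows "fractional_ideal A (order_multiples A v)"
proof -
  have v: "v \<in> carrier (rat_ext A)" using assms by (rule K.Units_closed)
  have iv: "inv\<^bsub>rat_ext A\<^esub> v \<in> carrier (rat_ext A)" using assms by simp
  obtain b k where b: "b \<in> carrier A" "k \<noteq> 0" "inv\<^bsub>rat_ext A\<^esub> v = frac A b k"
    by (rule rat_ext_cases[OF iv])
  have "of_order A b \<otimes>\<^bsub>rat_ext A\<^esub> v = int_elem k \<otimes>\<^bsub>rat_ext A\<^esub> (inv\<^bsub>rat_ext A\<^esub> v \<otimes>\<^bsub>rat_ext A\<^esub> v)"
    unfolding of_order_eq_frac[OF b(1,2), symmetric] b(3) using b v by (simp add: K.m_assoc)
  also have "\<dots> = int_elem k" using assms by simp
  finally have "int_elem k \<in> order_multiples A v" using b by (auto simp: order_multiples_def)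
  then show ?thesis
    unfolding fractional_ideal_iff using b v order_multiples_eq_span[OF v]
    by (intro conjI exI[of _ "{v}"] exI[of _ k]) auto
qed

section \<open>Invertible and principal ideals\<close>

lemma invertible_ideal_closed: "invertible_ideal A I \<Longrightarrow> I \<subseteq> carrier (rat_ext A)"
  by (auto simp: invertible_ideal_def dest: fractional_ideal_closed)

lemma invertible_ideal_multiples:
  assumes "v \<in> Units (rat_ext A)"
  shows "invertible_ideal A (order_multiples A v)"
proof -
  have "frac_ideal_mult A (order_multiples A v) (order_multiples A (inv\<^bsub>rat_ext A\<^esub> v)) =
      of_order A ` carrier A"
    using assms by (simp add: frac_ideal_mult_multiples K.Units_closed order_multiples_one)
  then show ?thesis
    unfolding invertible_ideal_def using assms fractional_ideal_multiples by (meson K.Units_inv_Units)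
qed

lemma ideal_group_simps [simp]:
  "carrier (ideal_group A) = {I. invertible_ideal A I}"
  "I \<otimes>\<^bsub>ideal_group A\<^esub> J = frac_ideal_mult A I J"
  "\<one>\<^bsub>ideal_group A\<^esub> = of_order A ` carrier A"
  by (simp_all add: ideal_group_def)

text \<open>With inverses I' of I and J' of J, the product I'J' is an inverse of IJ. An inverse of
  an invertible ideal is again invertible by commutativity.\<close>

lemma ideal_group_comm_group: "comm_group (ideal_group A)"
proof (rule comm_groupI, simp_all only: ideal_group_simps mem_Collect_eq)
  fix I J assume I: "invertible_ideal A I" and J: "invertible_ideal A J"
  note cl = invertible_ideal_closed[OF I] invertible_ideal_closed[OF J]
  show "frac_ideal_mult A I J = frac_ideal_mult A J I"
    using cl by (rule frac_ideal_mult_commute)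
  obtain I' J' where *: "fractional_ideal A I'" "fractional_ideal A J'"
    "frac_ideal_mult A I I' = of_order A ` carrier A" "frac_ideal_mult A J J' = of_order A ` carrier A"
    using I J by (auto simp: invertible_ideal_def)
  note cl' = *(1,2)[THEN fractional_ideal_closed]
  have "frac_ideal_mult A (frac_ideal_mult A I J) (frac_ideal_mult A I' J') =
      frac_ideal_mult A I (frac_ideal_mult A J (frac_ideal_mult A J' I'))"
    using cl cl' fractional_ideal_closed[OF fractional_ideal_mult[OF *(2,1)]]
    by (simp add: frac_ideal_mult_assoc frac_ideal_mult_commute[of I' J'])
  also have "frac_ideal_mult A J (frac_ideal_mult A J' I') = I'"
    using cl cl' *(4) frac_ideal_mult_one[OF fractional_ideal_submodule[OF *(1)]]
    by (simp flip: frac_ideal_mult_assoc)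
  finally have "frac_ideal_mult A (frac_ideal_mult A I J) (frac_ideal_mult A I' J') =
      of_order A ` carrier A" using *(3) by simp
  then show "invertible_ideal A (frac_ideal_mult A I J)"
    using I J * fractional_ideal_mult unfolding invertible_ideal_def by meson
next
  show "invertible_ideal A (of_order A ` carrier A)"
    using invertible_ideal_multiples[of "\<one>\<^bsub>rat_ext A\<^esub>"] by (simp add: order_multiples_one)
next
  fix I assume I: "invertible_ideal A I"
  then show "frac_ideal_mult A (of_order A ` carrier A) I = I"
    by (auto simp: invertible_ideal_def intro!: frac_ideal_mult_one dest: fractional_ideal_submodule)
  obtain J where J: "fractional_ideal A J" "frac_ideal_mult A I J = of_order A ` carrier A"
    using I by (auto simp: invertible_ideal_def)
  then have "frac_ideal_mult A J I = of_order A ` carrier A"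
    using I invertible_ideal_closed fractional_ideal_closed frac_ideal_mult_commute by metis
  then show "\<exists>J\<in>{I. invertible_ideal A I}. frac_ideal_mult A J I = of_order A ` carrier A"
    using J I unfolding invertible_ideal_def by blast
qed (simp add: frac_ideal_mult_assoc invertible_ideal_closed)

end

sublocale Z_order \<subseteq> ideals: comm_group "ideal_group A"
  by (rule ideal_group_comm_group)

context Z_order
begin

lemma inv_order_multiples:
  assumes "v \<in> Units (rat_ext A)"
  shows "inv\<^bsub>ideal_group A\<^esub> (order_multiples A v) = order_multiples A (inv\<^bsub>rat_ext A\<^esub> v)"
  by (rule ideals.inv_equality)
    (use assms in \<open>simp_all add: frac_ideal_mult_multiples K.Units_closed order_multiples_one
      invertible_ideal_multiples\<close>)

lemma principal_ideals_subgroup: "subgroup (principal_ideals A) (ideal_group A)"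
proof (rule ideals.subgroupI)
  show "principal_ideals A \<subseteq> carrier (ideal_group A)"
    by (auto simp: principal_ideals_def invertible_ideal_multiples)
  show "principal_ideals A \<noteq> {}" by (auto simp: principal_ideals_def intro: K.Units_one_closed)
qed (auto simp: principal_ideals_def inv_order_multiples frac_ideal_mult_multiples K.Units_closed)

end

section \<open>Conjugation of ideals and the weighted class group\<close>

context Z_order
begin

lemma invertible_ideal_mult:
  "invertible_ideal A I \<Longrightarrow> invertible_ideal A J \<Longrightarrow> invertible_ideal A (frac_ideal_mult A I J)"
  using ideals.m_closed[of I J] by simp

lemma invertible_ideal_ac:
  assumes "invertible_ideal A I" "invertible_ideal A J" "invertible_ideal A L"
  shows invertible_ideal_assoc:
      "frac_ideal_mult A (frac_ideal_mult A I J) L = frac_ideal_mult A I (frac_ideal_mult A J L)"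
    and invertible_ideal_lcomm:
      "frac_ideal_mult A I (frac_ideal_mult A J L) = frac_ideal_mult A J (frac_ideal_mult A I L)"
  using ideals.m_assoc[of I J L] ideals.m_lcomm[of I J L] assms by simp_all

lemma invertible_ideal_commute:
  "invertible_ideal A I \<Longrightarrow> invertible_ideal A J \<Longrightarrow> frac_ideal_mult A I J = frac_ideal_mult A J I"
  using ideals.m_comm[of I J] by simp

text \<open>The ideal Aw contains a non-zero integer n = a w, so a/n is an inverse of w. Applied to
  I bar I = Aw, this makes the second component of a pair a unit.\<close>

lemma invertible_multiples_unit:
  assumes "w \<in> carrier (rat_ext A)" "invertible_ideal A (order_multiples A w)"
  shows "w \<in> Units (rat_ext A)"
proof -
  obtain n a where n: "n \<noteq> 0" "a \<in> carrier A" "int_elem n = of_order A a \<otimes>\<^bsub>rat_ext A\<^esub> w"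
    using assms(2) by (auto simp: invertible_ideal_def fractional_ideal_iff order_multiples_def)
  have "w \<otimes>\<^bsub>rat_ext A\<^esub> (of_order A a \<otimes>\<^bsub>rat_ext A\<^esub> frac A \<one> n) = int_elem n \<otimes>\<^bsub>rat_ext A\<^esub> frac A \<one> n"
    using assms(1) n by (simp add: K.m_ac)
  also have "\<dots> = \<one>\<^bsub>rat_ext A\<^esub>" using n(1) by (simp add: of_order_eq_frac of_order_one)
  finally show ?thesis using assms(1) n by (intro Units_rat_extI) auto
qed

end

section \<open>Conjugate ideals and the ideal norm\<close>

context CM_order
begin

abbreviation bar_ideal :: "('a \<times> int) set set \<Rightarrow> ('a \<times> int) set set"
  where "bar_ideal I \<equiv> bar_ext A bar ` I"

lemma bar_ideal_closed: "I \<subseteq> carrier (rat_ext A) \<Longrightarrow> bar_ideal I \<subseteq> carrier (rat_ext A)"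
  by auto

lemma bar_ideal_bar_ideal: "I \<subseteq> carrier (rat_ext A) \<Longrightarrow> bar_ideal (bar_ideal I) = I"
  by (force simp: image_image subset_iff)

text \<open>Conjugation is only semilinear: a * bar x = bar (bar a * x), which uses that
  \<open>bar\<close> is an involution of A.\<close>

lemma bar_ideal_submodule:
  assumes M: "order_submodule M"
  shows "order_submodule (bar_ideal M)"
  unfolding order_submodule_iff[of "bar_ideal M"]
proof (intro conjI ballI)
  have cl: "M \<subseteq> carrier (rat_ext A)" using M by (rule order_submodule_closed)
  then show "bar_ideal M \<subseteq> carrier (rat_ext A)" by (rule bar_ideal_closed)
  have "bar_ext A bar \<zero>\<^bsub>rat_ext A\<^esub> = \<zero>\<^bsub>rat_ext A\<^esub>"
    using ring_hom_zero[OF bar_ext_hom] K.ring_axioms by blast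
  then show "\<zero>\<^bsub>rat_ext A\<^esub> \<in> bar_ideal M"
    using M by (intro image_eqI[of _ _ "\<zero>\<^bsub>rat_ext A\<^esub>"]) (auto simp: order_submodule_iff)
  {
    fix x y assume "x \<in> bar_ideal M" "y \<in> bar_ideal M"
    then obtain x' y' where *: "x' \<in> M" "y' \<in> M" "x = bar_ext A bar x'" "y = bar_ext A bar y'" by blast
    then have "x \<oplus>\<^bsub>rat_ext A\<^esub> y = bar_ext A bar (x' \<oplus>\<^bsub>rat_ext A\<^esub> y')"
      using cl by (subst bar_ext_add) auto
    then show "x \<oplus>\<^bsub>rat_ext A\<^esub> y \<in> bar_ideal M" using * M by (auto simp: order_submodule_iff)
  }
  {
    fix a x assume a: "a \<in> carrier A" and "x \<in> bar_ideal M"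
    then obtain x' where *: "x' \<in> M" "x = bar_ext A bar x'" by blast
    then have "of_order A a \<otimes>\<^bsub>rat_ext A\<^esub> x = bar_ext A bar (of_order A (bar a) \<otimes>\<^bsub>rat_ext A\<^esub> x')"
      using cl a by (subst bar_ext_mult) (auto simp: bar_ext_of_order)
    moreover have "of_order A (bar a) \<otimes>\<^bsub>rat_ext A\<^esub> x' \<in> M" using * M a by (simp add: order_submodule_iff)
    ultimately show "of_order A a \<otimes>\<^bsub>rat_ext A\<^esub> x \<in> bar_ideal M" by blast
  }
qed

text \<open>Both inclusions are minimality of a span; the first one is proved for the conjugated set
  and then conjugated back.\<close>

lemma bar_ideal_span:
  assumes S: "S \<subseteq> carrier (rat_ext A)"
  shows "bar_ideal (order_span A S) = order_span A (bar_ideal S)"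
proof
  have "order_submodule (bar_ideal (order_span A (bar_ideal S)))"
    by (intro bar_ideal_submodule order_span_submodule bar_ideal_closed S)
  moreover have "S \<subseteq> bar_ideal (order_span A (bar_ideal S))"
    using image_mono[OF order_span_superset[of "bar_ideal S"], of "bar_ext A bar"]
    by (simp only: bar_ideal_bar_ideal[OF S])
  ultimately have "order_span A S \<subseteq> bar_ideal (order_span A (bar_ideal S))"
    by (intro order_span_minimal)
  from image_mono[OF this, of "bar_ext A bar"]
  show "bar_ideal (order_span A S) \<subseteq> order_span A (bar_ideal S)"
    by (simp only: bar_ideal_bar_ideal[OF order_span_closed[OF bar_ideal_closed[OF S]]])
  show "order_span A (bar_ideal S) \<subseteq> bar_ideal (order_span A S)"
    by (intro order_span_minimal image_mono order_span_superset bar_ideal_submodule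
        order_span_submodule S)
qed

lemma bar_ideal_mult:
  assumes "I \<subseteq> carrier (rat_ext A)" "J \<subseteq> carrier (rat_ext A)"
  shows "bar_ideal (frac_ideal_mult A I J) = frac_ideal_mult A (bar_ideal I) (bar_ideal J)"
proof -
  have "bar_ext A bar (x \<otimes>\<^bsub>rat_ext A\<^esub> y) = bar_ext A bar x \<otimes>\<^bsub>rat_ext A\<^esub> bar_ext A bar y"
    if "x \<in> I" "y \<in> J" for x y using assms that by (intro bar_ext_mult) auto
  then have "bar_ideal (products I J) = products (bar_ideal I) (bar_ideal J)"
    by (auto simp: image_iff) metis+
  then show ?thesis
    unfolding frac_ideal_mult_def using bar_ideal_span[OF products_closed[OF assms]] by simp
qed

lemma bar_ideal_multiples:
  assumes "v \<in> carrier (rat_ext A)"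
  shows "bar_ideal (order_multiples A v) = order_multiples A (bar_ext A bar v)"
  using assms bar_ideal_span[of "{v}"] by (simp add: order_multiples_eq_span)

lemma bar_ideal_one: "bar_ideal (of_order A ` carrier A) = of_order A ` carrier A"
  using bar_ideal_multiples[of "\<one>\<^bsub>rat_ext A\<^esub>"] by (simp add: order_multiples_one bar_ext_one)

text \<open>Integers are fixed by conjugation, so the integer that witnesses the spanning condition
  for I also lies in the conjugate of I.\<close>

lemma bar_ideal_fractional:
  assumes "fractional_ideal A I"
  shows "fractional_ideal A (bar_ideal I)"
proof -
  obtain S n where S: "finite S" "S \<subseteq> carrier (rat_ext A)" "I = order_span A S"
    and n: "n \<noteq> 0" "int_elem n \<in> I"
    using assms by (auto simp: fractional_ideal_iff)
  have "bar_ext A bar (int_elem n) = int_elem n"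
    using ring_hom_one[OF bar_hom] by (simp add: bar_ext_of_order bar_add_pow)
  then have "int_elem n \<in> bar_ideal I" using n(2) by (metis imageI)
  then show ?thesis
    unfolding fractional_ideal_iff using S n bar_ideal_span[OF S(2)] bar_ideal_closed[OF S(2)]
    by (intro conjI exI[of _ "bar_ideal S"] exI[of _ n]) auto
qed

lemma bar_ideal_invertible:
  assumes "invertible_ideal A I"
  shows "invertible_ideal A (bar_ideal I)"
proof -
  obtain J where J: "fractional_ideal A J" "frac_ideal_mult A I J = of_order A ` carrier A"
    using assms by (auto simp: invertible_ideal_def)
  have "frac_ideal_mult A (bar_ideal I) (bar_ideal J) = of_order A ` carrier A"
    using bar_ideal_mult[of I J] J invertible_ideal_closed[OF assms] fractional_ideal_closed[OF J(1)]
    by (simp add: bar_ideal_one)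
  then show ?thesis
    using assms J bar_ideal_fractional unfolding invertible_ideal_def
    by (intro conjI exI[of _ "bar_ideal J"]) simp_all
qed

abbreviation ideal_norm :: "('a \<times> int) set set \<Rightarrow> ('a \<times> int) set set"
  where "ideal_norm I \<equiv> frac_ideal_mult A I (bar_ideal I)"

lemma ideal_norm_invertible: "invertible_ideal A I \<Longrightarrow> invertible_ideal A (ideal_norm I)"
  by (intro invertible_ideal_mult bar_ideal_invertible)

lemma ideal_norm_mult:
  assumes "invertible_ideal A I" "invertible_ideal A J"
  shows "ideal_norm (frac_ideal_mult A I J) = frac_ideal_mult A (ideal_norm I) (ideal_norm J)"
  using assms
  by (simp add: bar_ideal_mult invertible_ideal_closed bar_ideal_invertible invertible_ideal_mult
      invertible_ideal_assoc invertible_ideal_lcomm[of J "bar_ideal I"])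

lemma ideal_norm_multiples:
  assumes "v \<in> carrier (rat_ext A)"
  shows "ideal_norm (order_multiples A v) = order_multiples A (v \<otimes>\<^bsub>rat_ext A\<^esub> bar_ext A bar v)"
  using assms by (simp add: bar_ideal_multiples frac_ideal_mult_multiples)

lemma ideal_norm_one: "ideal_norm (of_order A ` carrier A) = of_order A ` carrier A"
  using ideal_norm_multiples[of "\<one>\<^bsub>rat_ext A\<^esub>"] by (simp add: order_multiples_one bar_ext_one)

section \<open>The group of pairs and its principal subgroup\<close>

lemma WPic_pairs_simps [simp]:
  "p \<otimes>\<^bsub>WPic_pairs A bar\<^esub> q = (frac_ideal_mult A (fst p) (fst q), snd p \<otimes>\<^bsub>rat_ext A\<^esub> snd q)"
  "\<one>\<^bsub>WPic_pairs A bar\<^esub> = (of_order A ` carrier A, \<one>\<^bsub>rat_ext A\<^esub>)"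
  by (simp_all add: WPic_pairs_def case_prod_beta)

lemma WPic_pairs_carrier:
  "(I, w) \<in> carrier (WPic_pairs A bar) \<longleftrightarrow>
     invertible_ideal A I \<and> w \<in> totally_positive A \<and> ideal_norm I = order_multiples A w"
  by (simp add: WPic_pairs_def)

lemma WPic_pairs_unit:
  assumes "(I, w) \<in> carrier (WPic_pairs A bar)"
  shows "w \<in> Units (rat_ext A)"
  using assms ideal_norm_invertible[of I]
  by (intro invertible_multiples_unit) (auto simp: WPic_pairs_carrier totally_positive_closed)

lemma WPic_pairs_comm_group: "comm_group (WPic_pairs A bar)"
proof (rule comm_groupI)
  let ?P = "WPic_pairs A bar"
  show "\<one>\<^bsub>?P\<^esub> \<in> carrier ?P"
    using ideals.one_closed totally_positive_one ideal_norm_one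
    by (simp add: WPic_pairs_carrier order_multiples_one)
next
  let ?P = "WPic_pairs A bar"
  fix p q assume "p \<in> carrier ?P" "q \<in> carrier ?P"
  moreover obtain I w J u where pq: "p = (I, w)" "q = (J, u)" by (cases p, cases q)
  ultimately have *: "invertible_ideal A I" "w \<in> totally_positive A" "ideal_norm I = order_multiples A w"
     "invertible_ideal A J" "u \<in> totally_positive A" "ideal_norm J = order_multiples A u"
    by (auto simp: WPic_pairs_carrier)
  then show "p \<otimes>\<^bsub>?P\<^esub> q \<in> carrier ?P"
    by (simp add: pq WPic_pairs_carrier invertible_ideal_mult totally_positive_mult ideal_norm_mult
        frac_ideal_mult_multiples totally_positive_closed)
  show "p \<otimes>\<^bsub>?P\<^esub> q = q \<otimes>\<^bsub>?P\<^esub> p"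
    using * by (simp add: pq invertible_ideal_commute K.m_comm totally_positive_closed)
  fix r assume "r \<in> carrier ?P"
  then show "p \<otimes>\<^bsub>?P\<^esub> q \<otimes>\<^bsub>?P\<^esub> r = p \<otimes>\<^bsub>?P\<^esub> (q \<otimes>\<^bsub>?P\<^esub> r)"
    using * by (cases r)
      (simp add: pq WPic_pairs_carrier invertible_ideal_assoc K.m_assoc totally_positive_closed)
next
  let ?P = "WPic_pairs A bar"
  fix p assume p: "p \<in> carrier ?P"
  obtain I w where p_eq: "p = (I, w)" by (cases p)
  with p have *: "invertible_ideal A I" "w \<in> totally_positive A" "ideal_norm I = order_multiples A w"
    by (auto simp: WPic_pairs_carrier)
  have w: "w \<in> Units (rat_ext A)" using WPic_pairs_unit p p_eq by simp
  show "\<one>\<^bsub>?P\<^esub> \<otimes>\<^bsub>?P\<^esub> p = p"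
    using * ideals.l_one[of I] by (simp add: p_eq totally_positive_closed)
  define J where "J = inv\<^bsub>ideal_group A\<^esub> I"
  have J: "invertible_ideal A J" "frac_ideal_mult A J I = of_order A ` carrier A"
    using * ideals.inv_closed[of I] ideals.l_inv[of I] by (simp_all add: J_def)
  \<comment> \<open>The ideal norm is multiplicative, so the norm of the inverse ideal is the
    inverse of Aw. Hence the inverse of w is the matching second component.\<close>
  have "frac_ideal_mult A (ideal_norm J) (ideal_norm I) = of_order A ` carrier A"
    using ideal_norm_mult[OF J(1) *(1)] J(2) by (simp add: ideal_norm_one)
  then have "inv\<^bsub>ideal_group A\<^esub> (order_multiples A w) = ideal_norm J"
    using * J ideal_norm_invertible[of J] ideal_norm_invertible[of I] by (intro ideals.inv_equality) auto
  then have "ideal_norm J = order_multiples A (inv\<^bsub>rat_ext A\<^esub> w)"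
    using inv_order_multiples[OF w] by simp
  then have "(J, inv\<^bsub>rat_ext A\<^esub> w) \<in> carrier ?P"
    using J totally_positive_inv[OF *(2) w] by (simp add: WPic_pairs_carrier)
  then show "\<exists>q\<in>carrier ?P. q \<otimes>\<^bsub>?P\<^esub> p = \<one>\<^bsub>?P\<^esub>"
    using J(2) w by (auto simp: p_eq intro!: bexI[of _ "(J, inv\<^bsub>rat_ext A\<^esub> w)"])
qed

end

sublocale CM_order \<subseteq> pairs: comm_group "WPic_pairs A bar"
  by (rule WPic_pairs_comm_group)

sublocale Z_order \<subseteq> principal: normal "principal_ideals A" "ideal_group A"
  by (rule ideals.subgroup_imp_normal[OF principal_ideals_subgroup])

context CM_order
begin

lemma WPic_principal_mem:
  "(I, w) \<in> WPic_principal A bar \<longleftrightarrow>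
    (\<exists>v\<in>Units (rat_ext A). I = order_multiples A v \<and> w = v \<otimes>\<^bsub>rat_ext A\<^esub> bar_ext A bar v)"
  by (auto simp: WPic_principal_def)

text \<open>The map v \<mapsto> (Av, v * bar v) is multiplicative on units, and the set is its
  image.\<close>

lemma WPic_principal_subgroup: "subgroup (WPic_principal A bar) (WPic_pairs A bar)"
proof (rule pairs.subgroupI)
  let ?P = "WPic_pairs A bar" and ?N = "WPic_principal A bar"
  show sub: "?N \<subseteq> carrier ?P"
    by (auto simp: WPic_principal_def WPic_pairs_carrier invertible_ideal_multiples
        totally_positive_norm ideal_norm_multiples K.Units_closed)
  show "?N \<noteq> {}" by (auto simp: WPic_principal_def intro: K.Units_one_closed)
  have mult: "(order_multiples A v, v \<otimes>\<^bsub>rat_ext A\<^esub> bar_ext A bar v) \<otimes>\<^bsub>?P\<^esub>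
        (order_multiples A u, u \<otimes>\<^bsub>rat_ext A\<^esub> bar_ext A bar u) =
      (order_multiples A (v \<otimes>\<^bsub>rat_ext A\<^esub> u),
        (v \<otimes>\<^bsub>rat_ext A\<^esub> u) \<otimes>\<^bsub>rat_ext A\<^esub> bar_ext A bar (v \<otimes>\<^bsub>rat_ext A\<^esub> u))"
    if "v \<in> Units (rat_ext A)" "u \<in> Units (rat_ext A)" for v u
    using that by (simp add: frac_ideal_mult_multiples K.Units_closed bar_ext_mult K.m_ac)
  show "p \<otimes>\<^bsub>?P\<^esub> q \<in> ?N" if "p \<in> ?N" "q \<in> ?N" for p q
  proof -
    obtain v u where "v \<in> Units (rat_ext A)" "u \<in> Units (rat_ext A)"
      "p = (order_multiples A v, v \<otimes>\<^bsub>rat_ext A\<^esub> bar_ext A bar v)"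
      "q = (order_multiples A u, u \<otimes>\<^bsub>rat_ext A\<^esub> bar_ext A bar u)"
      using \<open>p \<in> ?N\<close> \<open>q \<in> ?N\<close> unfolding WPic_principal_def by blast
    then show ?thesis
      using mult[of v u] K.Units_m_closed[of v u] unfolding WPic_principal_def by (auto simp del: WPic_pairs_simps)
  qed
  show "inv\<^bsub>?P\<^esub> p \<in> ?N" if "p \<in> ?N" for p
  proof -
    obtain v where v: "v \<in> Units (rat_ext A)"
      "p = (order_multiples A v, v \<otimes>\<^bsub>rat_ext A\<^esub> bar_ext A bar v)"
      using \<open>p \<in> ?N\<close> unfolding WPic_principal_def by blast
    let ?q = "(order_multiples A (inv\<^bsub>rat_ext A\<^esub> v),
      inv\<^bsub>rat_ext A\<^esub> v \<otimes>\<^bsub>rat_ext A\<^esub> bar_ext A bar (inv\<^bsub>rat_ext A\<^esub> v))"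
    have q: "?q \<in> ?N" using v by (auto simp: WPic_principal_def)
    have "?q \<otimes>\<^bsub>?P\<^esub> p = \<one>\<^bsub>?P\<^esub>"
      unfolding v(2) mult[OF K.Units_inv_Units[OF v(1)] v(1)]
      using v(1) by (simp add: order_multiples_one bar_ext_one)
    then have "inv\<^bsub>?P\<^esub> p = ?q" using q sub \<open>p \<in> ?N\<close> by (intro pairs.inv_equality) auto
    then show ?thesis using q by simp
  qed
qed

end

sublocale CM_order \<subseteq> principal_pairs: normal "WPic_principal A bar" "WPic_pairs A bar"
  by (rule pairs.subgroup_imp_normal[OF WPic_principal_subgroup])

section \<open>Classes and the homomorphism from pairs to ideal classes\<close>

context CM_order
begin

lemma WPic_group: "group (WPic A bar)"
  unfolding WPic_def by (rule principal_pairs.factorgroup_is_group)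

definition pair_class :: "('a \<times> int) set set \<times> ('a \<times> int) set \<Rightarrow>
    (('a \<times> int) set set \<times> ('a \<times> int) set) set"
  where "pair_class p = WPic_principal A bar #>\<^bsub>WPic_pairs A bar\<^esub> p"

lemma WPic_carrier: "carrier (WPic A bar) = pair_class ` carrier (WPic_pairs A bar)"
  by (simp add: WPic_def carrier_FactGroup pair_class_def[abs_def])

lemma WPic_mult:
  "p \<in> carrier (WPic_pairs A bar) \<Longrightarrow> q \<in> carrier (WPic_pairs A bar) \<Longrightarrow>
    pair_class p \<otimes>\<^bsub>WPic A bar\<^esub> pair_class q = pair_class (p \<otimes>\<^bsub>WPic_pairs A bar\<^esub> q)"
  unfolding WPic_def pair_class_def mult_FactGroup by (rule principal_pairs.rcos_sum)

lemma WPic_one_iff: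
  "p \<in> carrier (WPic_pairs A bar) \<Longrightarrow> pair_class p = \<one>\<^bsub>WPic A bar\<^esub> \<longleftrightarrow> p \<in> WPic_principal A bar"
  unfolding WPic_def pair_class_def one_FactGroup
  using pairs.coset_join1 pairs.coset_join2 WPic_principal_subgroup principal_pairs.subset by metis

lemma ideal_class_mult:
  "invertible_ideal A I \<Longrightarrow> invertible_ideal A J \<Longrightarrow>
    ideal_class A I \<otimes>\<^bsub>Cl A\<^esub> ideal_class A J = ideal_class A (frac_ideal_mult A I J)"
  unfolding Cl_def ideal_class_def mult_FactGroup using principal.rcos_sum[of I J] by simp

lemma ideal_class_one_iff:
  "invertible_ideal A I \<Longrightarrow> ideal_class A I = \<one>\<^bsub>Cl A\<^esub> \<longleftrightarrow> I \<in> principal_ideals A"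
  unfolding Cl_def ideal_class_def one_FactGroup
  using ideals.coset_join1[of "principal_ideals A" I] ideals.coset_join2[of I "principal_ideals A"]
    principal_ideals_subgroup principal.subset by auto

lemma Cl_comm_group: "comm_group (Cl A)"
  unfolding Cl_def by (rule ideals.abelian_FactGroup[OF principal_ideals_subgroup])

text \<open>The first component of any member of the coset is Av times I for a unit v, and the class
  of Av is trivial. The image to which \<open>the_elem\<close> is applied is therefore a
  singleton.\<close>

lemma WPic_to_Cl_pair_class:
  assumes "(I, w) \<in> carrier (WPic_pairs A bar)"
  shows "WPic_to_Cl A (pair_class (I, w)) = ideal_class A I"
proof -
  interpret Cl: comm_group "Cl A" by (rule Cl_comm_group)
  have I: "invertible_ideal A I" using assms by (simp add: WPic_pairs_carrier)
  have "(\<lambda>(I, w). ideal_class A I) ` pair_class (I, w) = (\<lambda>_. ideal_class A I) ` pair_class (I, w)"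
  proof (rule image_cong[OF refl])
    fix p assume "p \<in> pair_class (I, w)"
    then obtain v where v: "v \<in> Units (rat_ext A)"
      "fst p = frac_ideal_mult A (order_multiples A v) I"
      by (auto simp: pair_class_def r_coset_def WPic_principal_def)
    have "ideal_class A (order_multiples A v) = \<one>\<^bsub>Cl A\<^esub>"
      using v invertible_ideal_multiples by (subst ideal_class_one_iff) (auto simp: principal_ideals_def)
    moreover have "ideal_class A I \<in> carrier (Cl A)"
      using I by (auto simp: Cl_def carrier_FactGroup ideal_class_def)
    ultimately have "ideal_class A (fst p) = ideal_class A I"
      using ideal_class_mult[OF invertible_ideal_multiples[OF v(1)] I] v(2) by simp
    then show "(case p of (I, w) \<Rightarrow> ideal_class A I) = ideal_class A I" by (simp add: case_prod_beta)
  qed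
  moreover have "(I, w) \<in> pair_class (I, w)"
    unfolding pair_class_def using pairs.rcos_self[OF assms WPic_principal_subgroup] .
  ultimately show ?thesis unfolding WPic_to_Cl_def by (simp only: image_constant the_elem_eq)
qed

text \<open>The ideals behind \<open>Cl_minus\<close> before passing to classes. At this level the
  condition is a preimage under the multiplicative ideal norm, which makes the subgroup property
  visible.\<close>

definition norm_principal :: "('a \<times> int) set set set"
  where "norm_principal = {I. invertible_ideal A I \<and> ideal_norm I \<in> principal_ideals A}"

lemma Cl_minus_carrier: "carrier (Cl_minus A bar) = ideal_class A ` norm_principal"
  by (auto simp: Cl_minus_def norm_principal_def)

lemma Cl_minus_simps [simp]:
  "x \<otimes>\<^bsub>Cl_minus A bar\<^esub> y = x \<otimes>\<^bsub>Cl A\<^esub> y" "\<one>\<^bsub>Cl_minus A bar\<^esub> = \<one>\<^bsub>Cl A\<^esub>"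
  by (simp_all add: Cl_minus_def)

text \<open>The preimage of the principal ideals under the ideal norm is a subgroup of the ideal
  group; the quotient map sends it to a subgroup of \<open>Cl A\<close>.\<close>

lemma Cl_minus_subgroup: "subgroup (ideal_class A ` norm_principal) (Cl A)"
proof -
  have "subgroup norm_principal (ideal_group A)"
  proof (rule ideals.subgroupI)
    show "norm_principal \<subseteq> carrier (ideal_group A)" by (auto simp: norm_principal_def)
    have "of_order A ` carrier A \<in> norm_principal"
      using ideals.one_closed subgroup.one_closed[OF principal_ideals_subgroup]
      by (simp add: norm_principal_def ideal_norm_one)
    then show "norm_principal \<noteq> {}" by blast
  next
    fix I J assume "I \<in> norm_principal" "J \<in> norm_principal"
    then show "I \<otimes>\<^bsub>ideal_group A\<^esub> J \<in> norm_principal"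
      using subgroup.m_closed[OF principal_ideals_subgroup, of "ideal_norm I" "ideal_norm J"]
      by (simp add: norm_principal_def ideal_norm_mult invertible_ideal_mult)
  next
    fix I assume I: "I \<in> norm_principal"
    define J where "J = inv\<^bsub>ideal_group A\<^esub> I"
    have J: "invertible_ideal A J" "frac_ideal_mult A J I = of_order A ` carrier A"
      using I ideals.inv_closed[of I] ideals.l_inv[of I] by (simp_all add: J_def norm_principal_def)
    have "frac_ideal_mult A (ideal_norm J) (ideal_norm I) = of_order A ` carrier A"
      using ideal_norm_mult[of J I] I J by (simp add: ideal_norm_one norm_principal_def)
    then have "inv\<^bsub>ideal_group A\<^esub> (ideal_norm I) = ideal_norm J"
      using I J ideal_norm_invertible[of J] ideal_norm_invertible[of I]
      by (intro ideals.inv_equality) (auto simp: norm_principal_def)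
    then show "inv\<^bsub>ideal_group A\<^esub> I \<in> norm_principal"
      using J(1) subgroup.m_inv_closed[OF principal_ideals_subgroup, of "ideal_norm I"] I
      by (simp add: norm_principal_def flip: J_def)
  qed
  moreover have "group_hom (ideal_group A) (Cl A) (ideal_class A)"
    using principal.r_coset_hom_Mod Cl_comm_group
    by (auto simp: group_hom_def group_hom_axioms_def Cl_def ideal_class_def[abs_def]
        intro: ideals.group_axioms comm_group.axioms)
  ultimately show ?thesis by (intro group_hom.subgroup_img_is_subgroup)
qed

lemma Cl_minus_comm_group: "comm_group (Cl_minus A bar)"
proof -
  have "Cl_minus A bar = (Cl A)\<lparr>carrier := ideal_class A ` norm_principal\<rparr>"
    unfolding Cl_minus_carrier[symmetric] by (simp add: Cl_minus_def)
  moreover have "group ((Cl A)\<lparr>carrier := ideal_class A ` norm_principal\<rparr>)"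
    using Cl_comm_group Cl_minus_subgroup
    by (intro subgroup.subgroup_is_group comm_group.axioms(2))
  ultimately have "group (Cl_minus A bar)" by simp
  then show ?thesis
  proof (rule group.group_comm_groupI)
    fix x y assume "x \<in> carrier (Cl_minus A bar)" "y \<in> carrier (Cl_minus A bar)"
    then have "x \<in> carrier (Cl A)" "y \<in> carrier (Cl A)"
      using subgroup.subset[OF Cl_minus_subgroup] by (auto simp: Cl_minus_carrier)
    then show "x \<otimes>\<^bsub>Cl_minus A bar\<^esub> y = y \<otimes>\<^bsub>Cl_minus A bar\<^esub> x"
      using comm_monoid.m_comm[OF comm_group.axioms(1)[OF Cl_comm_group]] by simp
  qed
qed

lemma WPic_to_Cl_hom: "group_hom (WPic A bar) (Cl_minus A bar) (WPic_to_Cl A)"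
proof -
  have "WPic_to_Cl A \<in> hom (WPic A bar) (Cl_minus A bar)"
  proof (rule homI)
    fix x assume "x \<in> carrier (WPic A bar)"
    then obtain I w where x: "(I, w) \<in> carrier (WPic_pairs A bar)" "x = pair_class (I, w)"
      by (auto simp: WPic_carrier)
    \<comment> \<open>Membership in \<open>principal_ideals\<close> requires a unit as generator; w
      is one because Aw is invertible.\<close>
    then have "I \<in> norm_principal"
      using WPic_pairs_unit[OF x(1)]
      by (auto simp: norm_principal_def WPic_pairs_carrier principal_ideals_def)
    then show "WPic_to_Cl A x \<in> carrier (Cl_minus A bar)"
      using x by (simp add: WPic_to_Cl_pair_class Cl_minus_carrier)
    fix y assume "y \<in> carrier (WPic A bar)"
    then obtain J u where y: "(J, u) \<in> carrier (WPic_pairs A bar)" "y = pair_class (J, u)"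
      by (auto simp: WPic_carrier)
    have "(frac_ideal_mult A I J, w \<otimes>\<^bsub>rat_ext A\<^esub> u) \<in> carrier (WPic_pairs A bar)"
      using pairs.m_closed[OF x(1) y(1)] by simp
    then show "WPic_to_Cl A (x \<otimes>\<^bsub>WPic A bar\<^esub> y) =
        WPic_to_Cl A x \<otimes>\<^bsub>Cl_minus A bar\<^esub> WPic_to_Cl A y"
      using x y by (simp add: WPic_mult WPic_to_Cl_pair_class ideal_class_mult WPic_pairs_carrier)
  qed
  then show ?thesis
    using WPic_group Cl_minus_comm_group
    by (simp add: group_hom_def group_hom_axioms_def comm_group.axioms)
qed

text \<open>The square has first component A v^2. Among the generators of this ideal, t is one whose
  norm t * bar t is exactly w^2.\<close>

lemma square_mem_WPic_principal:
  assumes p: "(I, w) \<in> carrier (WPic_pairs A bar)" and I: "I \<in> principal_ideals A"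
  shows "(I, w) \<otimes>\<^bsub>WPic_pairs A bar\<^esub> (I, w) \<in> WPic_principal A bar"
proof -
  let ?K = "rat_ext A" and ?bar = "bar_ext A bar"
  obtain v where v: "v \<in> Units ?K" "I = order_multiples A v"
    using I by (auto simp: principal_ideals_def)
  have w: "w \<in> Units ?K" "?bar w = w"
    using WPic_pairs_unit[OF p] totally_positive_real p by (auto simp: WPic_pairs_carrier)
  have bv: "?bar v \<in> Units ?K" using v(1) by (rule bar_ext_Units)
  note cl = v(1)[THEN K.Units_closed] w(1)[THEN K.Units_closed] bv[THEN K.Units_closed]
    K.Units_inv_closed[OF v(1)] K.Units_inv_closed[OF bv]
  \<comment> \<open>This is v^2 times w / (v * bar v), a unit of A because Aw = A (v * bar v). The
    factor v / bar v has norm 1, so the norm of t is w * bar w = w^2.\<close>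
  define t where "t = w \<otimes>\<^bsub>?K\<^esub> (v \<otimes>\<^bsub>?K\<^esub> inv\<^bsub>?K\<^esub> (?bar v))"
  have t: "t \<in> Units ?K" unfolding t_def using v w bv by simp
  have "order_multiples A w = order_multiples A (v \<otimes>\<^bsub>?K\<^esub> ?bar v)"
    using p v cl by (simp add: WPic_pairs_carrier ideal_norm_multiples)
  \<comment> \<open>Aw is replaced by A (v * bar v) as an ideal; the two generators themselves need
    not agree.\<close>
  then have "order_multiples A t = frac_ideal_mult A (order_multiples A (v \<otimes>\<^bsub>?K\<^esub> ?bar v))
      (order_multiples A (v \<otimes>\<^bsub>?K\<^esub> inv\<^bsub>?K\<^esub> (?bar v)))"
    unfolding t_def using cl by (simp add: frac_ideal_mult_multiples[symmetric])
  also have "\<dots> = order_multiples A (v \<otimes>\<^bsub>?K\<^esub> v \<otimes>\<^bsub>?K\<^esub> (?bar v \<otimes>\<^bsub>?K\<^esub> inv\<^bsub>?K\<^esub> (?bar v)))"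
    using cl by (subst frac_ideal_mult_multiples) (simp_all del: K.Units_r_inv add: K.m_ac)
  also have "\<dots> = frac_ideal_mult A I I"
    using v bv cl by (simp add: frac_ideal_mult_multiples)
  finally have II: "frac_ideal_mult A I I = order_multiples A t" by simp
  \<comment> \<open>The conjugate of the inverse of bar v is the inverse of v, stated as a product
    that equals 1 so that it can be cancelled directly.\<close>
  have "?bar (inv\<^bsub>?K\<^esub> (?bar v)) \<otimes>\<^bsub>?K\<^esub> v = ?bar (inv\<^bsub>?K\<^esub> (?bar v) \<otimes>\<^bsub>?K\<^esub> ?bar v)"
    using cl by (simp add: bar_ext_mult del: K.Units_l_inv)
  then have inv: "?bar (inv\<^bsub>?K\<^esub> (?bar v)) \<otimes>\<^bsub>?K\<^esub> v = \<one>\<^bsub>?K\<^esub>"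
    using bv by (simp add: bar_ext_one)
  have "t \<otimes>\<^bsub>?K\<^esub> ?bar t = (w \<otimes>\<^bsub>?K\<^esub> w) \<otimes>\<^bsub>?K\<^esub> ((?bar (inv\<^bsub>?K\<^esub> (?bar v)) \<otimes>\<^bsub>?K\<^esub> v) \<otimes>\<^bsub>?K\<^esub>
      (?bar v \<otimes>\<^bsub>?K\<^esub> inv\<^bsub>?K\<^esub> (?bar v)))"
    unfolding t_def using cl w(2) by (simp add: bar_ext_mult K.m_ac del: K.Units_r_inv)
  also have "\<dots> = w \<otimes>\<^bsub>?K\<^esub> w" unfolding inv using bv cl by simp
  finally show ?thesis using II t by (auto simp: WPic_principal_mem)
qed

text \<open>The norm of I^2 is also generated by u^2, but its complex values need not be positive.
  Exchanging one factor Au for the equal ideal A bar u gives the generator u * bar u, whose values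
  are squared moduli.\<close>

lemma square_mem_WPic_pairs:
  assumes "I \<in> norm_principal"
  shows "\<exists>w. (frac_ideal_mult A I I, w) \<in> carrier (WPic_pairs A bar)"
proof -
  have I: "invertible_ideal A I" using assms by (simp add: norm_principal_def)
  obtain u where u: "u \<in> Units (rat_ext A)" "ideal_norm I = order_multiples A u"
    using assms by (auto simp: norm_principal_def principal_ideals_def)
  \<comment> \<open>Conjugation interchanges the two factors of I bar I, so Au is equal to its
    conjugate.\<close>
  have "order_multiples A (bar_ext A bar u) = bar_ideal (ideal_norm I)"
    using u by (simp add: bar_ideal_multiples K.Units_closed)
  also have "\<dots> = frac_ideal_mult A (bar_ideal I) I"
    using invertible_ideal_closed[OF I]
    by (simp only: bar_ideal_mult bar_ideal_closed bar_ideal_bar_ideal)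
  also have "\<dots> = ideal_norm I"
    using I by (intro invertible_ideal_commute bar_ideal_invertible)
  finally have "ideal_norm (frac_ideal_mult A I I) = frac_ideal_mult A (order_multiples A u)
      (order_multiples A (bar_ext A bar u))"
    using ideal_norm_mult[OF I I] u(2) by simp
  also have "\<dots> = order_multiples A (u \<otimes>\<^bsub>rat_ext A\<^esub> bar_ext A bar u)"
    using u(1) by (simp add: frac_ideal_mult_multiples K.Units_closed)
  finally show ?thesis
    using totally_positive_norm[OF u(1)] invertible_ideal_mult[OF I I]
    by (auto simp: WPic_pairs_carrier)
qed

end

section \<open>Annihilation of the kernel and the cokernel by 2\<close>

lemma (in monoid) nat_pow_two: "x \<in> carrier G \<Longrightarrow> x [^] (2::nat) = x \<otimes> x"
  by (simp add: numeral_2_eq_2)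

theorem theorem12p3:
  fixes A :: "('a, 'm) ring_scheme" and bar :: "'a \<Rightarrow> 'a"
  assumes "CM_order A bar"
  shows "group_hom (WPic A bar) (Cl_minus A bar) (WPic_to_Cl A) \<and>
    (\<forall>x \<in> kernel (WPic A bar) (Cl_minus A bar) (WPic_to_Cl A).
       x [^]\<^bsub>WPic A bar\<^esub> (2::nat) = \<one>\<^bsub>WPic A bar\<^esub>) \<and>
    (let coker = Cl_minus A bar Mod (WPic_to_Cl A ` carrier (WPic A bar))
     in \<forall>y \<in> carrier coker. y [^]\<^bsub>coker\<^esub> (2::nat) = \<one>\<^bsub>coker\<^esub>)"
proof -
  interpret CM_order A bar by (rule assms)
  interpret h: group_hom "WPic A bar" "Cl_minus A bar" "WPic_to_Cl A" by (rule WPic_to_Cl_hom)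
  interpret Clm: comm_group "Cl_minus A bar" by (rule Cl_minus_comm_group)
  let ?H = "WPic_to_Cl A ` carrier (WPic A bar)"
  interpret H: normal ?H "Cl_minus A bar"
    by (rule Clm.subgroup_imp_normal[OF h.img_is_subgroup])
  interpret coker: group "Cl_minus A bar Mod ?H" by (rule H.factorgroup_is_group)
  have ker: "x [^]\<^bsub>WPic A bar\<^esub> (2::nat) = \<one>\<^bsub>WPic A bar\<^esub>"
    if x: "x \<in> kernel (WPic A bar) (Cl_minus A bar) (WPic_to_Cl A)" for x
  proof -
    obtain I w where p: "(I, w) \<in> carrier (WPic_pairs A bar)" "x = pair_class (I, w)"
      using x by (auto simp: kernel_def WPic_carrier)
    \<comment> \<open>\<open>Cl_minus\<close> inherits its identity from \<open>Cl\<close>, where a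
      trivial class means a principal ideal.\<close>
    then have "I \<in> principal_ideals A"
      using x ideal_class_one_iff[of I]
      by (simp add: kernel_def WPic_to_Cl_pair_class WPic_pairs_carrier)
    from square_mem_WPic_principal[OF p(1) this]
    have "pair_class ((I, w) \<otimes>\<^bsub>WPic_pairs A bar\<^esub> (I, w)) = \<one>\<^bsub>WPic A bar\<^esub>"
      using WPic_one_iff[OF pairs.m_closed[OF p(1) p(1)]] by blast
    moreover have "x [^]\<^bsub>WPic A bar\<^esub> (2::nat) = x \<otimes>\<^bsub>WPic A bar\<^esub> x"
      using x by (intro h.G.nat_pow_two) (simp add: kernel_def)
    ultimately show ?thesis using WPic_mult[OF p(1) p(1)] p(2) by simp
  qed
  have cok: "y [^]\<^bsub>Cl_minus A bar Mod ?H\<^esub> (2::nat) = \<one>\<^bsub>Cl_minus A bar Mod ?H\<^esub>"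
    if y: "y \<in> carrier (Cl_minus A bar Mod ?H)" for y
  proof -
    obtain I where I: "I \<in> norm_principal" "y = ?H #>\<^bsub>Cl_minus A bar\<^esub> ideal_class A I"
      using y by (auto simp: carrier_FactGroup Cl_minus_carrier)
    then have c: "ideal_class A I \<in> carrier (Cl_minus A bar)" by (simp add: Cl_minus_carrier)
    obtain w where w: "(frac_ideal_mult A I I, w) \<in> carrier (WPic_pairs A bar)"
      using square_mem_WPic_pairs[OF I(1)] by blast
    have "ideal_class A I \<otimes>\<^bsub>Cl_minus A bar\<^esub> ideal_class A I =
        WPic_to_Cl A (pair_class (frac_ideal_mult A I I, w))"
      using w I(1) by (simp add: WPic_to_Cl_pair_class ideal_class_mult norm_principal_def)
    then have "ideal_class A I \<otimes>\<^bsub>Cl_minus A bar\<^esub> ideal_class A I \<in> ?H"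
      using w by (auto simp: WPic_carrier)
    \<comment> \<open>The square of the class of I lies in the image of h, so its coset is the image
      itself, the identity of the cokernel.\<close>
    then have "?H #>\<^bsub>Cl_minus A bar\<^esub> (ideal_class A I \<otimes>\<^bsub>Cl_minus A bar\<^esub> ideal_class A I) = ?H"
      using c by (intro h.H.coset_join2 h.img_is_subgroup) (auto simp del: Cl_minus_simps)
    then have "y \<otimes>\<^bsub>Cl_minus A bar Mod ?H\<^esub> y = ?H"
      unfolding I(2) mult_FactGroup H.rcos_sum[OF c c] .
    then show ?thesis using coker.nat_pow_two[OF y] by simp
  qed
  show ?thesis unfolding Let_def using WPic_to_Cl_hom ker cok by blast
qed

end
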